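(* Let $p$ be an odd prime, $m$ an even positive integer, $M=\mathbb F_{p^m}$, $Q=p^{m/2}$, $1\le k\le m-1$, $q=p^k$, $r=p^{k+m/2}$, $e=\gcd(k,m)$ with $m/e$ odd, $d=\gcd(k+m/2,m)$, $\mathbb E=\mathbb F_{p^e}$, $\mathbb D=\mathbb F_{p^d}$. Let $B\in M$ be a non-square and $A\in M$ with $AB\in\mathbb F_Q^\times$, and let $\mathcal C$ be the spread set described in the context. Suppose $X,Y$ are invertible $\mathbb F_p$-linear maps of $M\times M$ with $\{X\circ R\circ Y^{-1}:R\in\mathcal C\}=\mathcal C$. Then $Y$ is semilinear over $\mathbb E$ and $X$ is semilinear over $\mathbb D$.
   Context: One has $e=2d$, $\mathbb E=\mathbb F_q\cap M$ and $\mathbb D=\mathbb F_r\cap M\subseteq \mathbb E$. $\mathcal C=\{R_{u,v}:u,v\in M\}$ where $R_{u,v}(x,y)=(x^qu+xu^q+B(y^qv+yv^q),\ x^rv+Axv^r+Ay^ru+yu^r)$ for $x,y\in M$. A map $Z$ of $M\times M$ is semilinear over a subfield $K\subseteq M$ if it is additive and there is a field automorphism $\sigma$ of $K$ with $Z(\lambda x,\lambda y)=\sigma(\lambda)Z(x,y)$ for all $\lambda\in K$, $x,y\in M$. *)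

theory Defs
  imports "HOL-Computational_Algebra.Primes" "HOL-Library.Product_Plus"
begin

definition is_subfield :: "'a::field set \<Rightarrow> bool" where
  "is_subfield K \<longleftrightarrow>
     0 \<in> K \<and> 1 \<in> K \<and>
     (\<forall>x\<in>K. \<forall>y\<in>K. x + y \<in> K \<and> x * y \<in> K) \<and>
     (\<forall>x\<in>K. - x \<in> K \<and> inverse x \<in> K)"

text \<open>
  In a finite field of order \<open>p ^ m\<close> there is, for each divisor \<open>n\<close> of \<open>m\<close>, exactly one
  subset \<open>K\<close> with \<open>is_GF (p ^ n) K\<close>, namely the subfield of order \<open>p ^ n\<close>.
\<close>

definition is_GF :: "nat \<Rightarrow> 'a::{field,finite} set \<Rightarrow> bool" where
  "is_GF n K \<longleftrightarrow> is_subfield K \<and> card K = n"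

definition field_automorphism_on :: "'a::field set \<Rightarrow> ('a \<Rightarrow> 'a) \<Rightarrow> bool" where
  "field_automorphism_on K \<sigma> \<longleftrightarrow>
     bij_betw \<sigma> K K \<and> \<sigma> 1 = 1 \<and>
     (\<forall>x\<in>K. \<forall>y\<in>K. \<sigma> (x + y) = \<sigma> x + \<sigma> y \<and> \<sigma> (x * y) = \<sigma> x * \<sigma> y)"

definition scale2 :: "'a::field \<Rightarrow> 'a \<times> 'a \<Rightarrow> 'a \<times> 'a" where
  "scale2 c z = (c * fst z, c * snd z)"

definition linear_over :: "'a::field set \<Rightarrow> ('a \<times> 'a \<Rightarrow> 'a \<times> 'a) \<Rightarrow> bool" where
  "linear_over K Z \<longleftrightarrow>
     (\<forall>z w. Z (z + w) = Z z + Z w) \<and> (\<forall>c\<in>K. \<forall>z. Z (scale2 c z) = scale2 c (Z z))"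

definition semilinear_over :: "'a::field set \<Rightarrow> ('a \<times> 'a \<Rightarrow> 'a \<times> 'a) \<Rightarrow> bool" where
  "semilinear_over K Z \<longleftrightarrow>
     (\<forall>z w. Z (z + w) = Z z + Z w) \<and>
     (\<exists>\<sigma>. field_automorphism_on K \<sigma> \<and>
          (\<forall>c\<in>K. \<forall>z. Z (scale2 c z) = scale2 (\<sigma> c) (Z z)))"

definition spread_map ::
  "nat \<Rightarrow> nat \<Rightarrow> 'a::field \<Rightarrow> 'a \<Rightarrow> 'a \<Rightarrow> 'a \<Rightarrow> 'a \<times> 'a \<Rightarrow> 'a \<times> 'a" where
  "spread_map q r A B u v = (\<lambda>(x, y).
     (x ^ q * u + x * u ^ q + B * (y ^ q * v + y * v ^ q),
      x ^ r * v + A * x * v ^ r + A * y ^ r * u + y * u ^ r))"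

definition spread_set ::
  "nat \<Rightarrow> nat \<Rightarrow> 'a::field \<Rightarrow> 'a \<Rightarrow> ('a \<times> 'a \<Rightarrow> 'a \<times> 'a) set" where
  "spread_set q r A B = {spread_map q r A B u v | u v. True}"

end

theory Submission
  imports Defs "HOL-Computational_Algebra.Polynomial"
begin

text \<open>
  Write \<open>\<phi> x = x ^ q\<close> and \<open>bar x = x ^ Q\<close>. After replacing \<open>y\<close> by \<open>bar y\<close>, the spread set is the
  multiplication of a commutative presemifield in which both components are obtained from the
  entries of the matrix \<open>\<phi> z * w\<^sup>T + \<phi> w * z\<^sup>T\<close>. An autotopism \<open>X (z * w) = Y z * W w\<close> makes
  \<open>W \<circ> inv Y\<close> an element of the middle nucleus, which consists of the scalars fixed by \<open>\<phi>\<close>, and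
  \<open>Y\<close> normalises this nucleus. Hence the matrix of \<open>(Y z, Y w)\<close> is an additive function of the
  matrix of \<open>(z, w)\<close>, and comparing the coefficients of the linearised polynomials of the components of
  \<open>Y\<close> shows that they are all monomials with one common exponent \<open>p ^ s\<close>. The relation between the two
  diagonal entries then forces \<open>Y\<close> to be diagonal or antidiagonal, because \<open>B\<close> is a non-square. In
  the original coordinates this makes \<open>Y\<close> semilinear, and \<open>X\<close> inherits semilinearity over \<open>D\<close>
  from \<open>X (z * w) = Y z * W w\<close>.
\<close>

section \<open>Finite fields\<close>

text \<open>Translation by 1 permutes the field, so comparing the sum of all elements with the
  translated sum gives \<open>p ^ m = 0\<close> in the field; the characteristic is a prime dividing
  \<open>p ^ m\<close>.\<close>

lemma CHAR_eq_of_card_UNIV: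
  assumes "prime p" and card: "card (UNIV :: 'a::{field,finite} set) = p ^ m"
  shows "CHAR('a) = p"
proof -
  have "(\<Sum>y::'a\<in>UNIV. y + 1) = (\<Sum>y::'a\<in>UNIV. y)"
    by (rule sum.reindex_bij_witness[of _ "\<lambda>y. y - 1" "\<lambda>y. y + 1"]) auto
  hence "of_nat (p ^ m) = (0 :: 'a)"
    using card by (simp add: sum.distrib)
  hence "CHAR('a) dvd p ^ m"
    by (simp only: of_nat_eq_0_iff_char_dvd)
  moreover have "prime CHAR('a)"
    by (intro prime_CHAR_semidom finite_imp_CHAR_pos) simp
  ultimately show ?thesis
    using \<open>prime p\<close> by (metis prime_dvd_power primes_dvd_imp_eq)
qed

lemma power_prime_power_add:
  fixes x y :: "'a::{field,finite}"
  assumes "prime p" and "card (UNIV :: 'a set) = p ^ m"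
  shows "(x + y) ^ (p ^ i) = x ^ (p ^ i) + y ^ (p ^ i)"
  by (rule freshmans_dream') (simp_all add: CHAR_eq_of_card_UNIV[OF assms] assms(1))

text \<open>Multiplication by a nonzero \<open>c\<close> permutes \<open>K - {0}\<close>; comparing
  the two products over this set gives \<open>c ^ (n - 1) = 1\<close>.\<close>

lemma is_GF_power_card:
  assumes "is_GF n K" and "c \<in> K"
  shows "c ^ n = c"
proof (cases "c = 0")
  case True
  have "n > 0"
    using assms by (auto simp: is_GF_def card_gt_0_iff)
  with True show ?thesis by simp
next
  case False
  have K: "0 \<in> K" "\<And>x y. x \<in> K \<Longrightarrow> y \<in> K \<Longrightarrow> x * y \<in> K" "\<And>x. x \<in> K \<Longrightarrow> inverse x \<in> K"
    and n: "card K = n"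
    using assms by (auto simp: is_GF_def is_subfield_def)
  have "(\<Prod>y\<in>K-{0}. c * y) = (\<Prod>y\<in>K-{0}. y)"
    by (rule prod.reindex_bij_witness[of _ "\<lambda>y. inverse c * y" "\<lambda>y. c * y"])
       (use False K assms(2) in \<open>auto simp flip: mult.assoc\<close>)
  hence "c ^ card (K - {0}) = 1"
    by (simp add: prod.distrib)
  moreover have "n = Suc (card (K - {0}))"
    using K(1) n by (metis card.remove finite)
  ultimately show ?thesis by simp
qed

lemma power_card_UNIV:
  fixes x :: "'a::{field,finite}"
  assumes "card (UNIV :: 'a set) = n"
  shows "x ^ n = x"
  using is_GF_power_card[of n "UNIV :: 'a set" x] assms by (simp add: is_GF_def is_subfield_def)

lemma power_power_multiple:
  fixes x :: "'a::monoid_mult"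
  assumes "x ^ (p ^ n) = x" and "n dvd j"
  shows "x ^ (p ^ j) = x"
proof -
  have "x ^ (p ^ (n * l)) = x" for l
    by (induction l) (simp_all add: power_add power_mult assms(1))
  with assms(2) show ?thesis by blast
qed

lemma power_power_add_multiple:
  fixes x :: "'a::monoid_mult"
  assumes "x ^ (p ^ n) = x" and "n dvd j"
  shows "x ^ (p ^ (i + j)) = x ^ (p ^ i)"
  using power_power_multiple[OF assms] by (metis add.commute power_add power_mult)

lemma card_power_eq_self_le:
  assumes "n > 1"
  shows "card {x::'a::{field,finite}. x ^ n = x} \<le> n"
proof -
  let ?P = "monom (1::'a) n - monom 1 1"
  have "coeff ?P n = 1"
    using assms by simp
  hence "?P \<noteq> 0" by (metis coeff_0 zero_neq_one)
  have "degree ?P \<le> n"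
    using assms by (intro degree_diff_le) (auto intro: order.trans[OF degree_monom_le])
  with card_poly_roots_bound[OF \<open>?P \<noteq> 0\<close>] show ?thesis
    by (simp add: poly_monom)
qed

text \<open>Euler's criterion by counting: squaring has fibres of at most two elements, so there are
  at least \<open>l\<close> nonzero squares. All are roots of \<open>x ^ l - 1\<close>, which has at
  most \<open>l\<close> roots.\<close>

lemma finite_field_squareI:
  fixes b :: "'a::{field,finite}"
  assumes "odd (card (UNIV :: 'a set))" and "b ^ ((card (UNIV :: 'a set) - 1) div 2) = 1"
  shows "\<exists>c. b = c ^ 2"
proof -
  define N where "N = card (UNIV :: 'a set)"
  define l where "l = (N - 1) div 2"
  have N: "N = 2 * l + 1"
    using assms(1) unfolding l_def N_def by presburger
  have "card {0, 1 :: 'a} \<le> N"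
    unfolding N_def by (intro card_mono) auto
  hence "l > 0" using N by simp
  let ?S = "(\<lambda>c. c ^ 2) ` (UNIV - {0::'a})"
  let ?R = "{x::'a. poly (monom 1 l - 1) x = 0}"
  have fib: "card {c \<in> UNIV - {0}. c ^ 2 = s} \<le> 2" for s :: 'a
  proof (cases "\<exists>c. c ^ 2 = s")
    case True
    then obtain c where "c ^ 2 = s" by blast
    hence "{c \<in> UNIV - {0}. c ^ 2 = s} \<subseteq> {c, - c}"
      by (auto simp: power2_eq_iff)
    hence "card {c \<in> UNIV - {0}. c ^ 2 = s} \<le> card {c, - c}"
      by (intro card_mono) auto
    thus ?thesis
      using card_insert_le_m1[of 2 "{- c}" c] by simp
  next
    case False
    hence "{c \<in> UNIV - {0}. c ^ 2 = s} = {}" by blast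
    thus ?thesis by (simp only: card.empty)
  qed
  have "2 * l = card (UNIV - {0::'a})"
    using N by (simp add: N_def card_Diff_subset)
  also have "\<dots> = card (\<Union>s\<in>?S. {c \<in> UNIV - {0}. c ^ 2 = s})"
    by (rule arg_cong[of _ _ card]) auto
  also have "\<dots> \<le> (\<Sum>s\<in>?S. card {c \<in> UNIV - {0}. c ^ 2 = s})"
    by (intro card_UN_le) simp
  also have "\<dots> \<le> (\<Sum>s\<in>?S. 2)"
    by (intro sum_mono fib)
  finally have 1: "l \<le> card ?S" by simp
  have sub: "?S \<subseteq> ?R"
  proof
    fix s assume "s \<in> ?S"
    then obtain c where c: "c \<noteq> 0" "s = c ^ 2" by auto
    have "c ^ N = c"
      by (rule power_card_UNIV) (simp add: N_def)
    hence "s ^ l = 1"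
      using c N by (simp add: power_mult)
    thus "s \<in> ?R" by (simp add: poly_monom)
  qed
  have "coeff (monom 1 l - 1 :: 'a poly) l = 1"
    using \<open>l > 0\<close> by simp
  hence "monom 1 l - 1 \<noteq> (0 :: 'a poly)" by (metis coeff_0 zero_neq_one)
  hence "card ?R \<le> degree (monom 1 l - 1 :: 'a poly)"
    by (rule card_poly_roots_bound)
  also have "\<dots> \<le> l"
    by (intro degree_diff_le) (auto intro: order.trans[OF degree_monom_le])
  finally have "?S = ?R"
    using 1 sub by (intro card_seteq) auto
  moreover have "b \<in> ?R"
    using assms(2) by (simp add: poly_monom l_def N_def)
  ultimately show ?thesis by auto
qed

section \<open>Linearised polynomials\<close>

text \<open>The degree is at most \<open>p ^ (m - 1)\<close>, while every one of the
  \<open>p ^ m\<close> field elements is a root.\<close>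

lemma p_polynomial_unique:
  fixes c :: "nat \<Rightarrow> 'a::{field,finite}"
  assumes "prime p" and card: "card (UNIV :: 'a set) = p ^ m"
    and zero: "\<And>x. (\<Sum>i<m. c i * x ^ (p ^ i)) = 0" and "i < m"
  shows "c i = 0"
proof -
  have p: "p > 1" using \<open>prime p\<close> by (rule prime_gt_1_nat)
  define P where "P = (\<Sum>i<m. monom (c i) (p ^ i))"
  have "degree P \<le> p ^ (m - 1)"
    unfolding P_def using p
    by (intro degree_sum_le) (auto intro!: order.trans[OF degree_monom_le] power_increasing)
  also have "\<dots> < p ^ m"
    using p \<open>i < m\<close> by (intro power_strict_increasing) auto
  finally have deg: "degree P < p ^ m" .
  have "poly P x = 0" for x
    using zero[of x] by (simp add: P_def poly_sum poly_monom)
  hence "{x. poly P x = 0} = UNIV" by blast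
  hence "P = 0"
    using card_poly_roots_bound[of P] deg card by fastforce
  hence "0 = coeff P (p ^ i)" by simp
  also have "\<dots> = (\<Sum>j<m. if j = i then c j else 0)"
    unfolding P_def coeff_sum using p by (intro sum.cong) (auto simp: power_inject_exp)
  also have "\<dots> = c i" using \<open>i < m\<close> by simp
  finally show ?thesis by simp
qed

section \<open>Additive maps as linearised polynomials\<close>

lemma additive_zero:
  fixes h :: "'a::ab_group_add \<Rightarrow> 'b::ab_group_add"
  assumes "\<And>x y. h (x + y) = h x + h y"
  shows "h 0 = 0"
  using assms[of 0 0] by simp

text \<open>Spanning over the prime field is expressed through additive maps. At
  \<open>j = m\<close> the size bound forces \<open>H = UNIV\<close>, so that \<open>m\<close>
  values determine an additive map.\<close>

lemma additive_subgroup_generators: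
  assumes "prime p" and card: "card (UNIV :: 'a::{field,finite} set) = p ^ m" and "j \<le> m"
  shows "\<exists>gs H. length gs = j \<and> p ^ j \<le> card H \<and> 0 \<in> H \<and> (\<forall>x\<in>H. \<forall>y\<in>H. x + y \<in> H) \<and>
           (\<forall>h::'a \<Rightarrow> 'a. (\<forall>x y. h (x + y) = h x + h y) \<longrightarrow> (\<forall>g\<in>set gs. h g = 0) \<longrightarrow> (\<forall>x\<in>H. h x = 0))"
  using \<open>j \<le> m\<close>
proof (induction j)
  case 0
  show ?case
    by (intro exI[of _ "[]"] exI[of _ "{0}"]) (simp add: additive_zero)
next
  case (Suc j)
  then obtain gs H where H: "length gs = j" "p ^ j \<le> card H" "0 \<in> H"
      "\<forall>x\<in>H. \<forall>y\<in>H. x + y \<in> H"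
      "\<forall>h::'a \<Rightarrow> 'a. (\<forall>x y. h (x + y) = h x + h y) \<longrightarrow> (\<forall>g\<in>set gs. h g = 0) \<longrightarrow> (\<forall>x\<in>H. h x = 0)"
    using Suc.IH[OF Suc_leD[OF Suc.prems]] by blast
  have char: "of_nat p = (0 :: 'a)"
    using of_nat_CHAR[where ?'a = 'a] CHAR_eq_of_card_UNIV[OF assms(1) card] by simp
  show ?case
  proof (cases "H = UNIV")
    \<comment> \<open>Nothing is left to add; the list is padded with 0 to reach the required
      length.\<close>
    case True
    have "p ^ Suc j \<le> p ^ m"
      using Suc.prems prime_gt_0_nat[OF \<open>prime p\<close>] by (intro power_increasing) auto
    hence "p ^ Suc j \<le> card H"
      using True card by simp
    with H show ?thesis
      by (intro exI[of _ "0 # gs"] exI[of _ H]) (simp del: power_Suc)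
  next
    case False
    then obtain g where g: "g \<notin> H" by blast
    have mult: "of_nat i * x \<in> H" if "x \<in> H" for i x
      by (induction i) (use that H(3,4) in \<open>auto simp: algebra_simps\<close>)
    have minus: "x - y \<in> H" if "x \<in> H" "y \<in> H" for x y
    proof -
      have "of_nat (p - 1) = (- 1 :: 'a)"
        using char prime_gt_0_nat[OF \<open>prime p\<close>] by (simp add: of_nat_diff)
      with mult[OF that(2), of "p - 1"] H(4) that(1) show ?thesis by force
    qed
    \<comment> \<open>\<open>H'\<close> enlarges \<open>H\<close> by the multiples of
      \<open>g\<close>. Admitting all natural multipliers makes closure under addition immediate;
      the multipliers below \<open>p\<close> already give \<open>p * card H\<close>
      elements.\<close>
    define f where "f = (\<lambda>(i, s). of_nat i * g + s)"
    define H' where "H' = f ` (UNIV \<times> H)"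
    \<comment> \<open>If two sums with different multipliers below \<open>p\<close> agreed,
      inverting the difference of the multipliers modulo \<open>p\<close> would put \<open>g\<close>
      into \<open>H\<close>.\<close>
    have le: "i \<ge> i'" if "i < p" "i' < p" "s \<in> H" "s' \<in> H"
      and eq: "of_nat i * g + s = of_nat i' * g + s'" for i i' :: nat and s s'
    proof (rule ccontr)
      assume "\<not> i \<ge> i'"
      hence i: "0 < i' - i" "i' - i < p" using that by auto
      hence "\<not> p dvd i' - i" by (metis dvd_imp_le not_le)
      then obtain a b where ab: "(i' - i) * a = Suc (p * b)"
        using bezout_prime[OF \<open>prime p\<close>] by blast
      have "of_nat (i' - i) * g = s - s'"
        using eq \<open>\<not> i \<ge> i'\<close> by (simp add: of_nat_diff algebra_simps)
      hence "of_nat a * (of_nat (i' - i) * g) \<in> H"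
        using mult minus that by simp
      moreover have "of_nat a * (of_nat (i' - i) * g) = of_nat ((i' - i) * a) * g"
        by (simp add: mult_ac)
      moreover have "of_nat ((i' - i) * a) = (1 :: 'a)"
        unfolding ab using char by simp
      ultimately show False using g by simp
    qed
    have "inj_on f ({..<p} \<times> H)"
    proof (rule inj_onI, clarsimp simp: f_def, rule conjI)
      fix i s i' s' assume *: "i < p" "s \<in> H" "i' < p" "s' \<in> H" "of_nat i * g + s = of_nat i' * g + s'"
      show "i = i'"
        using le[of i i' s s'] le[of i' i s' s] * by force
      thus "s = s'" using * by simp
    qed
    hence "card (f ` ({..<p} \<times> H)) = p * card H"
      by (simp add: card_image card_cartesian_product)
    moreover have "card (f ` ({..<p} \<times> H)) \<le> card H'"
      unfolding H'_def by (intro card_mono) auto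
    ultimately have card': "p ^ Suc j \<le> card H'"
      using mult_le_mono2[OF H(2), of p] by (simp only: power_Suc)
    show ?thesis
    proof (intro exI[of _ "g # gs"] exI[of _ H'] conjI allI impI ballI)
      show "0 \<in> H'"
        unfolding H'_def f_def by (rule image_eqI[of _ _ "(0, 0)"]) (use H(3) in simp_all)
      show "x + y \<in> H'" if xy: "x \<in> H'" "y \<in> H'" for x y
      proof -
        obtain i s i' s' where "x = of_nat i * g + s" "s \<in> H" "y = of_nat i' * g + s'" "s' \<in> H"
          using xy unfolding H'_def f_def by auto
        thus ?thesis
          unfolding H'_def f_def
          by (intro image_eqI[of _ _ "(i + i', s + s')"]) (use H(4) in \<open>auto simp: algebra_simps\<close>)
      qed
      show "h x = 0"
        if h: "\<forall>x y. h (x + y) = h x + h y" "\<forall>x\<in>set (g # gs). h x = 0" and x: "x \<in> H'"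
        for h :: "'a \<Rightarrow> 'a" and x
      proof -
        obtain i s where xs: "x = of_nat i * g + s" "s \<in> H"
          using x unfolding H'_def f_def by auto
        have "h (of_nat i * g) = 0" for i
          by (induction i) (use h in \<open>simp_all add: distrib_right additive_zero[of h]\<close>)
        moreover have "h s = 0"
          using H(5)[THEN spec, THEN mp, THEN mp, of h] h xs by simp
        ultimately show ?thesis
          using h xs by simp
      qed
    qed (use H(1) card' in \<open>simp_all only: list.size\<close>)
  qed
qed

text \<open>By uniqueness, the \<open>(p ^ m) ^ m\<close> coefficient lists give distinct additive
  maps. Since an additive map is determined by \<open>m\<close> values, there are no others.\<close>

lemma additive_imp_p_polynomial:
  fixes h :: "'a::{field,finite} \<Rightarrow> 'a"
  assumes "prime p" and card: "card (UNIV :: 'a set) = p ^ m"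
    and h: "\<And>x y. h (x + y) = h x + h y"
  obtains c where "\<And>x. h x = (\<Sum>i<m. c i * x ^ (p ^ i))"
proof -
  define A where "A = {h :: 'a \<Rightarrow> 'a. \<forall>x y. h (x + y) = h x + h y}"
  define L where "L = {cs :: 'a list. set cs \<subseteq> UNIV \<and> length cs = m}"
  define f where "f = (\<lambda>cs x. \<Sum>i<m. cs ! i * x ^ (p ^ i) :: 'a)"
  have L: "finite L" "card L = (p ^ m) ^ m"
    unfolding L_def by (simp_all only: card_lists_length_eq[OF finite] finite_lists_length_eq[OF finite] card)
  have "inj_on f L"
  proof (rule inj_onI)
    fix cs ds assume *: "cs \<in> L" "ds \<in> L" "f cs = f ds"
    have "cs ! i - ds ! i = 0" if "i < m" for i
      using fun_cong[OF *(3)] that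
      by (intro p_polynomial_unique[OF assms(1) card, of "\<lambda>i. cs ! i - ds ! i"])
         (simp_all add: f_def algebra_simps sum_subtractf)
    thus "cs = ds"
      using * by (intro nth_equalityI) (auto simp: L_def)
  qed
  hence "card (f ` L) = (p ^ m) ^ m"
    using L by (simp add: card_image)
  moreover have "f ` L \<subseteq> A"
    by (auto simp: A_def f_def power_prime_power_add[OF assms(1) card] algebra_simps sum.distrib)
  moreover have "card A \<le> (p ^ m) ^ m"
  proof -
    obtain gs H where gs: "length gs = m" "p ^ m \<le> card H"
      "\<forall>h::'a \<Rightarrow> 'a. (\<forall>x y. h (x + y) = h x + h y) \<longrightarrow> (\<forall>g\<in>set gs. h g = 0) \<longrightarrow> (\<forall>x\<in>H. h x = 0)"
      using additive_subgroup_generators[OF assms(1) card order.refl] by blast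
    have "H = UNIV"
      using gs(2) card by (intro card_seteq) auto
    have "inj_on (\<lambda>h. map h gs) A"
    proof (rule inj_onI)
      fix h h' assume *: "h \<in> A" "h' \<in> A" "map h gs = map h' gs"
      have "\<forall>x\<in>H. h x - h' x = 0"
        by (rule gs(3)[THEN spec, THEN mp, THEN mp]) (use * in \<open>simp_all add: A_def\<close>)
      thus "h = h'" using \<open>H = UNIV\<close> by auto
    qed
    moreover have "(\<lambda>h. map h gs) ` A \<subseteq> L"
      using gs(1) by (auto simp: L_def)
    ultimately have "card A \<le> card L"
      using L(1) by (intro card_inj_on_le)
    with L show ?thesis by simp
  qed
  ultimately have "f ` L = A"
    by (intro card_seteq) auto
  moreover have "h \<in> A" using h by (simp add: A_def)
  ultimately obtain cs where "h = f cs" by blast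
  thus ?thesis
    using that[of "\<lambda>i. cs ! i"] by (simp add: f_def)
qed

section \<open>Comparing coefficients in two variables\<close>

text \<open>Uniqueness in one variable is applied twice, because the coefficients of the powers of
  \<open>x\<close> are themselves linearised polynomials in \<open>u\<close>.\<close>

lemma p_polynomial_unique2:
  fixes C :: "nat \<Rightarrow> nat \<Rightarrow> 'a::{field,finite}"
  assumes "prime p" and card: "card (UNIV :: 'a set) = p ^ m"
    and zero: "\<And>x u. (\<Sum>s<m. \<Sum>t<m. C s t * (x ^ (p ^ s) * u ^ (p ^ t))) = 0"
    and "s < m" and "t < m"
  shows "C s t = 0"
proof -
  have "(\<Sum>t<m. C s t * u ^ (p ^ t)) = 0" for u
  proof (rule p_polynomial_unique[OF assms(1) card _ \<open>s < m\<close>, of "\<lambda>s. \<Sum>t<m. C s t * u ^ (p ^ t)"])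
    fix x
    show "(\<Sum>s<m. (\<Sum>t<m. C s t * u ^ (p ^ t)) * x ^ (p ^ s)) = 0"
      using zero[of x u] by (simp add: sum_distrib_left sum_distrib_right mult_ac)
  qed
  thus ?thesis
    by (rule p_polynomial_unique[OF assms(1) card _ \<open>t < m\<close>])
qed

lemma power_power_mod:
  fixes x :: "'a::{field,finite}"
  assumes "card (UNIV :: 'a set) = p ^ m"
  shows "x ^ (p ^ (i mod m)) = x ^ (p ^ i)"
  using power_power_add_multiple[OF power_card_UNIV[OF assms], of "m * (i div m)" x "i mod m"] by simp

lemma mod_shift_cancel:
  fixes i k m :: nat
  assumes "i < m" and "k < m"
  shows "((i + k) mod m + (m - k)) mod m = i" and "((i + (m - k)) mod m + k) mod m = i"
proof -
  have "i + k + (m - k) = i + m" "i + (m - k) + k = i + m"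
    using assms by simp_all
  thus "((i + k) mod m + (m - k)) mod m = i" "((i + (m - k)) mod m + k) mod m = i"
    using assms(1) by (simp_all only: mod_add_left_eq mod_add_self2 mod_less)
qed

text \<open>Frobenius exponents count modulo \<open>m\<close>, so the shift by \<open>k\<close> is a
  cyclic reindexing. Adding \<open>m - k\<close> replaces subtracting \<open>k\<close> within the
  natural numbers.\<close>

lemma p_polynomial_shift:
  fixes x :: "'a::{field,finite}"
  assumes card: "card (UNIV :: 'a set) = p ^ m" and "k < m"
  shows "(\<Sum>i<m. F i * x ^ (p ^ (i + k))) = (\<Sum>s<m. F ((s + (m - k)) mod m) * x ^ (p ^ s))"
proof (rule sum.reindex_bij_witness[of _ "\<lambda>s. (s + (m - k)) mod m" "\<lambda>i. (i + k) mod m"])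
  fix i assume "i \<in> {..<m}"
  thus inv: "((i + k) mod m + (m - k)) mod m = i"
    using \<open>k < m\<close> by (simp only: lessThan_iff mod_shift_cancel)
  show "(i + k) mod m \<in> {..<m}" using \<open>k < m\<close> by simp
  show "F (((i + k) mod m + (m - k)) mod m) * x ^ p ^ ((i + k) mod m) = F i * x ^ p ^ (i + k)"
    by (simp only: inv power_power_mod[OF card])
next
  fix s assume "s \<in> {..<m}"
  thus "((s + (m - k)) mod m + k) mod m = s"
    using \<open>k < m\<close> by (simp only: lessThan_iff mod_shift_cancel)
  show "(s + (m - k)) mod m \<in> {..<m}" using \<open>k < m\<close> by simp
qed

text \<open>
  Comparing coefficients of \<open>x ^ p ^ s * u ^ p ^ t\<close>: the right-hand side of \<open>eq\<close> only has terms with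
  \<open>s - t\<close> congruent to \<open>k\<close> or \<open>- k\<close> modulo \<open>m\<close>. The terms with \<open>s = t\<close> show that no two exponents
  of the \<open>h a c\<close> differ by \<open>k\<close>, so that the remaining terms cannot cancel.
\<close>
lemma additive_system_monomial:
  fixes h :: "'i \<Rightarrow> 'i \<Rightarrow> 'a::{field,finite} \<Rightarrow> 'a"
  assumes p: "prime p" and card: "card (UNIV :: 'a set) = p ^ m"
    and two: "(2::'a) \<noteq> 0" and k: "k < m" "\<not> m dvd 4 * k"
    and add: "\<And>a c x y. h a c (x + y) = h a c x + h a c y"
    and eq: "\<And>a b c d. \<exists>L L'. (\<forall>x y. L (x + y) = L x + L y) \<and> (\<forall>x y. L' (x + y) = L' x + L' y) \<and>
      (\<forall>x u. h a c x ^ (p ^ k) * h b d u + h b c x * h a d u ^ (p ^ k) =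
             L (x ^ (p ^ k) * u) + L' (x * u ^ (p ^ k)))"
  shows "\<exists>s. \<forall>a c. \<exists>\<eta>. \<forall>x. h a c x = \<eta> * x ^ (p ^ s)"
proof -
  have "\<forall>a c. \<exists>C. \<forall>x. h a c x = (\<Sum>i<m. C i * x ^ (p ^ i))"
  proof (intro allI)
    fix a c
    show "\<exists>C. \<forall>x. h a c x = (\<Sum>i<m. C i * x ^ (p ^ i))"
      using additive_imp_p_polynomial[OF p card, of "h a c"] add by metis
  qed
  then obtain \<eta> where \<eta>: "\<And>a c x. h a c x = (\<Sum>i<m. \<eta> a c i * x ^ (p ^ i))"
    by metis
  define \<alpha> where "\<alpha> = (\<lambda>a c s. \<eta> a c ((s + (m - k)) mod m) ^ (p ^ k))"
  have hq: "h a c x ^ (p ^ k) = (\<Sum>s<m. \<alpha> a c s * x ^ (p ^ s))" for a c x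
  proof -
    have "h a c x ^ (p ^ k) = (\<Sum>i<m. (\<eta> a c i * x ^ (p ^ i)) ^ (p ^ k))"
      unfolding \<eta> by (rule freshmans_dream_sum') (simp_all add: CHAR_eq_of_card_UNIV[OF p card] p)
    also have "\<dots> = (\<Sum>i<m. \<eta> a c i ^ (p ^ k) * x ^ (p ^ (i + k)))"
      by (simp add: power_mult_distrib power_add power_mult)
    also have "\<dots> = (\<Sum>s<m. \<alpha> a c s * x ^ (p ^ s))"
      unfolding \<alpha>_def by (rule p_polynomial_shift[OF card k(1)])
    finally show ?thesis .
  qed
  have star: "\<alpha> a c s * \<eta> b d t + \<eta> b c s * \<alpha> a d t = 0"
    if st: "s < m" "t < m" "s \<noteq> (t + k) mod m" "t \<noteq> (s + k) mod m" for a b c d s t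
  proof -
    from eq obtain L L' where
      L: "\<And>x y. L (x + y) = L x + L y" and L': "\<And>x y. L' (x + y) = L' x + L' y" and
      LL': "\<And>x u. h a c x ^ (p ^ k) * h b d u + h b c x * h a d u ^ (p ^ k) =
             L (x ^ (p ^ k) * u) + L' (x * u ^ (p ^ k))"
      by metis
    obtain l where l: "\<And>x. L x = (\<Sum>i<m. l i * x ^ (p ^ i))"
      using additive_imp_p_polynomial[OF p card L] by blast
    obtain l' where l': "\<And>x. L' x = (\<Sum>i<m. l' i * x ^ (p ^ i))"
      using additive_imp_p_polynomial[OF p card L'] by blast
    define C where "C = (\<lambda>s t. \<alpha> a c s * \<eta> b d t + \<eta> b c s * \<alpha> a d t
      - (if s = (t + k) mod m then l t else 0) - (if t = (s + k) mod m then l' s else 0))"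
    have "C s t = 0"
    proof (rule p_polynomial_unique2[OF p card _ st(1,2)])
      fix x u
      have "h a c x ^ (p ^ k) * h b d u =
          (\<Sum>s<m. \<Sum>t<m. (\<alpha> a c s * \<eta> b d t) * (x ^ (p ^ s) * u ^ (p ^ t)))"
        unfolding hq unfolding \<eta> sum_product by (simp add: mult_ac)
      moreover have "h b c x * h a d u ^ (p ^ k) =
          (\<Sum>s<m. \<Sum>t<m. (\<eta> b c s * \<alpha> a d t) * (x ^ (p ^ s) * u ^ (p ^ t)))"
        unfolding hq unfolding \<eta> sum_product by (simp add: mult_ac)
      moreover have "L (x ^ (p ^ k) * u) =
          (\<Sum>s<m. \<Sum>t<m. (if s = (t + k) mod m then l t else 0) * (x ^ (p ^ s) * u ^ (p ^ t)))"
      proof -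
        have "L (x ^ (p ^ k) * u) = (\<Sum>t<m. l t * (x ^ (p ^ ((t + k) mod m)) * u ^ (p ^ t)))"
          unfolding l power_power_mod[OF card]
          by (simp add: power_mult_distrib power_add mult.commute flip: power_mult)
        also have "\<dots> = (\<Sum>t<m. \<Sum>s<m. if s = (t + k) mod m then l t * (x ^ (p ^ s) * u ^ (p ^ t)) else 0)"
          using k(1) by simp
        also have "\<dots> = (\<Sum>s<m. \<Sum>t<m. if s = (t + k) mod m then l t * (x ^ (p ^ s) * u ^ (p ^ t)) else 0)"
          by (rule sum.swap)
        also have "\<dots> = (\<Sum>s<m. \<Sum>t<m. (if s = (t + k) mod m then l t else 0) * (x ^ (p ^ s) * u ^ (p ^ t)))"
          by (intro sum.cong) auto
        finally show ?thesis .
      qed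
      moreover have "L' (x * u ^ (p ^ k)) =
          (\<Sum>s<m. \<Sum>t<m. (if t = (s + k) mod m then l' s else 0) * (x ^ (p ^ s) * u ^ (p ^ t)))"
      proof -
        have "L' (x * u ^ (p ^ k)) = (\<Sum>s<m. l' s * (x ^ (p ^ s) * u ^ (p ^ ((s + k) mod m))))"
          unfolding l' power_power_mod[OF card]
          by (simp add: power_mult_distrib power_add mult.commute flip: power_mult)
        also have "\<dots> = (\<Sum>s<m. \<Sum>t<m. if t = (s + k) mod m then l' s * (x ^ (p ^ s) * u ^ (p ^ t)) else 0)"
          using k(1) by simp
        also have "\<dots> = (\<Sum>s<m. \<Sum>t<m. (if t = (s + k) mod m then l' s else 0) * (x ^ (p ^ s) * u ^ (p ^ t)))"
          by (intro sum.cong) auto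
        finally show ?thesis .
      qed
      ultimately show "(\<Sum>s<m. \<Sum>t<m. C s t * (x ^ (p ^ s) * u ^ (p ^ t))) = 0"
        using LL'[of x u]
        by (simp add: C_def left_diff_distrib distrib_right sum_subtractf sum.distrib)
    qed
    with st show ?thesis by (simp add: C_def)
  qed
  have noteq: "s \<noteq> (s + k) mod m" if "s < m" for s
  proof
    assume "s = (s + k) mod m"
    hence "(s + k) mod m = s mod m"
      using that by simp
    hence "m dvd k"
      by (simp add: mod_eq_dvd_iff_nat)
    thus False using k by auto
  qed
  \<comment> \<open>At \<open>s = t\<close> and \<open>c = d\<close> the relation
    \<open>star\<close> says that twice a product vanishes, which is where odd characteristic
    enters. For other \<open>d\<close> this removes the second product of \<open>star\<close>, and
    so the first.\<close>
  have A: "\<alpha> a c s = 0 \<or> \<eta> b d s = 0" if s: "s < m" for a b c d s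
  proof (rule ccontr)
    assume *: "\<not> (\<alpha> a c s = 0 \<or> \<eta> b d s = 0)"
    have diag: "\<alpha> a c s = 0 \<or> \<eta> b c s = 0" for a b c
      using star[OF s s noteq[OF s] noteq[OF s], of a c b c] two
      by (auto simp: mult.commute simp flip: mult_2)
    show False
      using star[OF s s noteq[OF s] noteq[OF s], of a c b d] diag[of a d b] *
      by auto
  qed
  \<comment> \<open>A nonzero coefficient at \<open>s\<close> gives a nonzero
    \<open>\<alpha>\<close> at \<open>s + k\<close>, and by \<open>A\<close> the second product of
    \<open>star\<close> vanishes there. A nonzero coefficient at \<open>t\<close> must then sit at
    an exceptional position of \<open>star\<close>.\<close>
  have B: "s = t \<or> t = (s + 2 * k) mod m"
    if st: "s < m" "t < m" "\<eta> a c s \<noteq> 0" "\<eta> b d t \<noteq> 0" for a b c d s t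
  proof -
    define s' where "s' = (s + k) mod m"
    have s': "s' < m" using k unfolding s'_def by simp
    have unshift: "(s' + (m - k)) mod m = s" if "s < m" "s' = (s + k) mod m" for s
      using mod_shift_cancel(1)[OF that(1) k(1)] that(2) by simp
    have "\<alpha> a c s' \<noteq> 0"
      using st(3) unshift[OF st(1) s'_def] by (simp add: \<alpha>_def)
    moreover then have "\<eta> b c s' = 0"
      using A[OF s', of a c b c] by blast
    ultimately have "s' = (t + k) mod m \<or> t = (s' + k) mod m"
      using star[OF s' st(2), of a c b d] st(4) by auto
    thus ?thesis
    proof
      assume "s' = (t + k) mod m"
      with unshift[OF st(2)] unshift[OF st(1) s'_def] show ?thesis by simp
    next
      assume "t = (s' + k) mod m"
      thus ?thesis by (simp add: s'_def mod_add_left_eq mult_2 add.assoc)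
    qed
  qed
  have single: "s = t" if st: "s < m" "t < m" "\<eta> a c s \<noteq> 0" "\<eta> b d t \<noteq> 0" for a b c d s t
  proof (rule ccontr)
    assume "s \<noteq> t"
    hence t: "t = (s + 2 * k) mod m" and s: "s = (t + 2 * k) mod m"
      using B[OF st] B[OF st(2,1,4,3)] by auto
    have "s = (s + 2 * k + 2 * k) mod m"
      using s unfolding t by (simp add: mod_add_left_eq)
    hence "(s + 4 * k) mod m = s mod m"
      using st(1) by (simp add: add.assoc)
    hence "m dvd 4 * k"
      by (simp add: mod_eq_dvd_iff_nat)
    with k show False by blast
  qed
  show ?thesis
  proof (cases "\<exists>a c s. s < m \<and> \<eta> a c s \<noteq> 0")
    case True
    then obtain a c s where s: "s < m" "\<eta> a c s \<noteq> 0" by blast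
    have "h b d x = \<eta> b d s * x ^ (p ^ s)" for b d x
    proof -
      have "h b d x = (\<Sum>i<m. if i = s then \<eta> b d i * x ^ (p ^ i) else 0)"
        unfolding \<eta> using single[OF s(1) _ s(2), of _ b d] by (intro sum.cong) auto
      thus ?thesis using s(1) by simp
    qed
    thus ?thesis by blast
  next
    \<comment> \<open>All maps vanish, so any exponent serves.\<close>
    case False
    hence "h b d x = 0" for b d x
      by (simp add: \<eta>)
    thus ?thesis by (intro exI[of _ 0] allI) simp
  qed
qed

section \<open>Autotopisms of the presemifield\<close>

lemma fst_scale2: "fst (scale2 c z) = c * fst z" and snd_scale2: "snd (scale2 c z) = c * snd z"
  by (simp_all add: scale2_def)

text \<open>The properties of \<open>x ^ q\<close> and \<open>x ^ Q\<close> on which the argument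
  rests. The odd order of \<open>\<phi>\<close> enters through \<open>phi_uminus_fixed\<close> and
  \<open>phi_phi_fixed\<close>; the last three assumptions produce the squares that are played off
  against \<open>B_nonsquare\<close>.\<close>

locale twisted_semifield =
  fixes \<phi> bar :: "'a::{field,finite} \<Rightarrow> 'a" and A B :: 'a
  assumes phi_add: "\<phi> (x + y) = \<phi> x + \<phi> y"
    and phi_mult: "\<phi> (x * y) = \<phi> x * \<phi> y"
    and phi_one: "\<phi> 1 = 1"
    and bar_add: "bar (x + y) = bar x + bar y"
    and bar_mult: "bar (x * y) = bar x * bar y"
    and bar_bar: "bar (bar x) = x"
    and phi_bar: "\<phi> (bar x) = bar (\<phi> x)"
    and two: "(2::'a) \<noteq> 0"
    and phi_uminus_fixed: "\<phi> x = - x \<Longrightarrow> x = 0"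
    and phi_phi_fixed: "\<phi> (\<phi> x) = x \<Longrightarrow> \<phi> x = x"
    and phi_phi_nontrivial: "\<exists>x. \<phi> (\<phi> x) \<noteq> x"
    and bar_nontrivial: "\<exists>\<mu>. \<phi> \<mu> = \<mu> \<and> bar \<mu> \<noteq> \<mu>"
    and AB_fixed: "bar A * bar B = A * B"
    and AB_nonzero: "A * B \<noteq> 0"
    and B_nonsquare: "\<nexists>c. B = c ^ 2"
    and square_phi: "\<exists>c. x * \<phi> x = c ^ 2"
    and square_bar_fixed: "bar \<kappa> = \<kappa> \<Longrightarrow> \<exists>c. \<kappa> = c ^ 2"
    and norm_nonsquare: "bar \<kappa> = \<kappa> \<Longrightarrow> b * bar b = \<kappa> * \<phi> \<kappa> \<Longrightarrow> \<exists>c. b = c ^ 2"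
begin

lemma A_nonzero [simp]: "A \<noteq> 0" and B_nonzero [simp]: "B \<noteq> 0"
  using AB_nonzero by auto

lemma phi_zero [simp]: "\<phi> 0 = 0"
  by (rule additive_zero[OF phi_add])

lemma phi_minus: "\<phi> (x - y) = \<phi> x - \<phi> y"
  using phi_add[of "x - y" y] by (simp add: eq_diff_eq)

lemma phi_eq_0 [simp]: "\<phi> x = 0 \<longleftrightarrow> x = 0"
  using phi_mult[of x "inverse x"] phi_one by (cases "x = 0") auto

lemma phi_divide: "\<phi> (x / y) = \<phi> x / \<phi> y"
  using phi_mult[of "x / y" y] by (cases "y = 0") (auto simp: field_simps)

lemma phi_inject: "\<phi> x = \<phi> y \<Longrightarrow> x = y"
  using phi_minus[of x y] by simp

lemma bar_zero [simp]: "bar 0 = 0"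
  by (rule additive_zero[OF bar_add])

lemma bar_eq_0 [simp]: "bar x = 0 \<longleftrightarrow> x = 0"
  using bar_bar[of x] bar_zero by metis

lemma bar_one [simp]: "bar 1 = 1"
  using bar_mult[of 1 1] bar_eq_0[of 1] by simp

lemma bar_diff: "bar (x - y) = bar x - bar y"
  using bar_add[of "x - y" y] by (simp add: eq_diff_eq)

lemma bar_uminus: "bar (- x) = - bar x"
  using bar_diff[of 0 x] by simp

lemma bar_divide: "bar (x / y) = bar x / bar y"
  using bar_mult[of "x / y" y] by (cases "y = 0") (auto simp: field_simps)

text \<open>
  The entries of the matrix \<open>\<phi> z * w\<^sup>T + \<phi> w * z\<^sup>T\<close>, selected by the projections \<open>a\<close> and \<open>b\<close>.
\<close>
definition form :: "('a \<times> 'a \<Rightarrow> 'a) \<Rightarrow> ('a \<times> 'a \<Rightarrow> 'a) \<Rightarrow> 'a \<times> 'a \<Rightarrow> 'a \<times> 'a \<Rightarrow> 'a" where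
  "form a b z w = \<phi> (a z) * b w + \<phi> (a w) * b z"

text \<open>
  In terms of \<open>bar\<close>, the map \<open>spread_map q r A B u v\<close> sends \<open>(x, y)\<close> to
  \<open>mul (x, bar y) (u, bar v)\<close> (lemma \<open>spread_map_eq_mul\<close> below). After this change of the second
  coordinate the multiplication factors through \<open>form\<close>.
\<close>
definition mul :: "'a \<times> 'a \<Rightarrow> 'a \<times> 'a \<Rightarrow> 'a \<times> 'a" where
  "mul z w = (form fst fst z w + B * bar (form snd snd z w),
              bar (form fst snd z w) + A * form snd fst z w)"

section \<open>Scalars and the absence of zero divisors\<close>

lemma mul_commute: "mul z w = mul w z"
  by (simp add: mul_def form_def algebra_simps)

lemma form_scale_left: "\<phi> c = c \<Longrightarrow> a \<in> {fst, snd} \<Longrightarrow> b \<in> {fst, snd} \<Longrightarrow>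
    form a b (scale2 c z) w = c * form a b z w"
  by (auto simp: form_def scale2_def phi_mult algebra_simps)

lemma form_scale_right: "\<phi> c = c \<Longrightarrow> a \<in> {fst, snd} \<Longrightarrow> b \<in> {fst, snd} \<Longrightarrow>
    form a b z (scale2 c w) = c * form a b z w"
  by (auto simp: form_def scale2_def phi_mult algebra_simps)

lemma mul_scale: "\<phi> c = c \<Longrightarrow> mul (scale2 c z) w = mul z (scale2 c w)"
  by (simp add: mul_def form_scale_left form_scale_right)

lemma mul_add_left: "mul (z + z') w = mul z w + mul z' w"
  by (simp add: mul_def form_def phi_add bar_add distrib_right distrib_left)

lemma mul_diff_left: "mul (z - z') w = mul z w - mul z' w"
  using mul_add_left[of "z - z'" z' w] by (simp add: eq_diff_eq)

lemma mul_zero [simp]: "mul 0 w = 0" "mul z 0 = 0"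
  using mul_diff_left[of 0 0 w] mul_diff_left[of 0 0 z] mul_commute[of z 0] by simp_all

text \<open>Up to sign, \<open>\<Delta> * \<phi> \<Delta>\<close> is the determinant of the matrix
  of forms. A zero product makes it \<open>B\<close> times an element fixed by \<open>bar\<close>,
  hence \<open>B\<close> times a square, which forces \<open>\<Delta> = 0\<close>. For parallel
  nonzero vectors the first component then writes the norm \<open>B * bar B\<close> in a form that
  \<open>norm_nonsquare\<close> allows only for squares.\<close>

lemma mul_eq_0_iff: "mul z w = 0 \<longleftrightarrow> z = 0 \<or> w = 0"
proof
  assume "mul z w = 0"
  obtain x y u v where zw: "z = (x, y)" "w = (u, v)" by fastforce
  define P1 where "P1 = \<phi> x * u + \<phi> u * x"
  define P2 where "P2 = \<phi> y * v + \<phi> v * y"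
  define P3 where "P3 = \<phi> x * v + \<phi> u * y"
  define P4 where "P4 = \<phi> y * u + \<phi> v * x"
  have eq1: "P1 = - (B * bar P2)" and eq2: "bar P3 = - (A * P4)"
    using \<open>mul z w = 0\<close>
    by (simp_all add: mul_def form_def zw P1_def P2_def P3_def P4_def zero_prod_def eq_neg_iff_add_eq_0)
  define \<Delta> where "\<Delta> = x * v - y * u"
  define n2 where "n2 = P2 * bar P2"
  define n4 where "n4 = P4 * bar P4"
  have fixed: "bar n2 = n2" "bar n4 = n4"
    by (simp_all add: n2_def n4_def bar_mult bar_bar)
  have P3: "P3 = - (bar A * bar P4)"
    using arg_cong[OF eq2, of bar] by (simp add: bar_bar bar_uminus bar_mult)
  have "\<Delta> * \<phi> \<Delta> = P3 * P4 - P1 * P2"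
    by (simp add: \<Delta>_def P1_def P2_def P3_def P4_def phi_minus phi_mult algebra_simps)
  also have "\<dots> = B * n2 - bar A * n4"
    unfolding P3 eq1 n2_def n4_def by (simp add: algebra_simps)
  finally have det: "\<Delta> * \<phi> \<Delta> = B * n2 - bar A * n4" .
  have "\<Delta> = 0"
  proof (rule ccontr)
    assume "\<Delta> \<noteq> 0"
    define E where "E = A * B"
    define N where "N = B * bar B"
    \<comment> \<open>Factoring out \<open>B\<close> leaves the coefficient
      \<open>bar A / B\<close>, which equals \<open>E / N\<close> by \<open>AB_fixed\<close> and is
      thus visibly fixed by \<open>bar\<close>.\<close>
    define \<kappa> where "\<kappa> = n2 - E * n4 / N"
    have "bar E = E" "bar N = N"
      using AB_fixed by (simp_all add: E_def N_def bar_mult bar_bar)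
    hence "bar \<kappa> = \<kappa>"
      by (simp add: \<kappa>_def bar_diff bar_divide bar_mult fixed)
    then obtain c where c: "\<kappa> = c ^ 2" using square_bar_fixed by blast
    have "\<Delta> * \<phi> \<Delta> = B * \<kappa>"
      unfolding det \<kappa>_def E_def N_def AB_fixed[symmetric] by (simp add: field_simps)
    moreover obtain g where "\<Delta> * \<phi> \<Delta> = g ^ 2" using square_phi by blast
    ultimately have "B * c ^ 2 = g ^ 2" and "c \<noteq> 0"
      using c \<open>\<Delta> \<noteq> 0\<close> by auto
    hence "B = (g / c) ^ 2" by (simp add: field_simps)
    thus False using B_nonsquare by blast
  qed
  show "z = 0 \<or> w = 0"
  proof (rule ccontr)
    assume "\<not> (z = 0 \<or> w = 0)"
    hence nz: "x \<noteq> 0 \<or> y \<noteq> 0" "u \<noteq> 0 \<or> v \<noteq> 0"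
      by (auto simp: zw zero_prod_def)
    obtain \<mu> where \<mu>: "u = \<mu> * x" "v = \<mu> * y"
    proof (cases "x = 0")
      case False
      thus ?thesis
        using that[of "u / x"] \<open>\<Delta> = 0\<close> by (simp add: \<Delta>_def field_simps)
    next
      case True
      thus ?thesis
        using that[of "v / y"] \<open>\<Delta> = 0\<close> nz by (simp add: \<Delta>_def)
    qed
    \<comment> \<open>For \<open>w\<close> equal to \<open>\<mu>\<close> times \<open>z\<close>,
      both diagonal forms carry the factor \<open>\<nu>\<close>, which cancels after taking
      norms.\<close>
    define \<nu> where "\<nu> = \<mu> + \<phi> \<mu>"
    have "\<mu> \<noteq> 0" using \<mu> nz by auto
    hence "\<nu> \<noteq> 0"
      using phi_uminus_fixed[of \<mu>] by (auto simp: \<nu>_def add_eq_0_iff)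
    have P: "P1 = x * \<phi> x * \<nu>" "P2 = y * \<phi> y * \<nu>"
      by (simp_all add: P1_def P2_def \<nu>_def \<mu> phi_mult algebra_simps)
    have "y \<noteq> 0"
      using eq1 P nz \<open>\<nu> \<noteq> 0\<close> by auto
    define \<kappa> where "\<kappa> = (x * bar x) / (y * bar y)"
    have "bar \<kappa> = \<kappa>"
      by (simp add: \<kappa>_def bar_divide bar_mult bar_bar mult.commute)
    have "P1 * bar P1 = B * bar B * (P2 * bar P2)"
      unfolding eq1 by (simp add: bar_uminus bar_mult bar_bar)
    hence "(x * bar x) * (\<phi> x * bar (\<phi> x)) * (\<nu> * bar \<nu>) =
           B * bar B * ((y * bar y) * (\<phi> y * bar (\<phi> y))) * (\<nu> * bar \<nu>)"
      unfolding P by (simp add: bar_mult mult_ac)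
    hence "(x * bar x) * (\<phi> x * bar (\<phi> x)) = B * bar B * ((y * bar y) * (\<phi> y * bar (\<phi> y)))"
      using \<open>\<nu> \<noteq> 0\<close> by simp
    hence "B * bar B = \<kappa> * \<phi> \<kappa>"
      using \<open>y \<noteq> 0\<close> by (simp add: \<kappa>_def phi_divide phi_mult phi_bar field_simps)
    with \<open>bar \<kappa> = \<kappa>\<close> norm_nonsquare B_nonsquare show False by blast
  qed
qed auto

lemma mul_left_cancel: "w \<noteq> 0 \<Longrightarrow> mul z w = mul z' w \<Longrightarrow> z = z'"
  using mul_eq_0_iff[of "z - z'" w] by (simp add: mul_diff_left)

lemma surj_mul: "w \<noteq> 0 \<Longrightarrow> surj (\<lambda>z. mul z w)"
  by (intro finite_UNIV_inj_surj) (auto intro: injI mul_left_cancel)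

section \<open>The middle nucleus\<close>

text \<open>Subtracting \<open>bar \<mu>\<close> times the first equation from the second eliminates
  \<open>y\<close> and \<open>y'\<close>. This separates the two forms that are added in each
  component of \<open>mul\<close>.\<close>

lemma bar_system_unique:
  assumes \<mu>: "bar \<mu> \<noteq> \<mu>" and "b \<noteq> 0" and eq: "x + b * bar y = x' + b * bar y'"
    and eq': "\<mu> * x + b * bar (\<mu> * y) = \<mu> * x' + b * bar (\<mu> * y')"
  shows "x = x' \<and> y = y'"
proof -
  have "(\<mu> - bar \<mu>) * (x - x') = 0"
  proof -
    have "(\<mu> - bar \<mu>) * (x - x') =
        (\<mu> * x + b * bar (\<mu> * y) - (\<mu> * x' + b * bar (\<mu> * y'))) - bar \<mu> * (x + b * bar y - (x' + b * bar y'))"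
      by (simp add: bar_mult algebra_simps)
    thus ?thesis using eq eq' by simp
  qed
  hence "x = x'" using \<mu> by simp
  moreover from this have "bar y = bar y'" using eq \<open>b \<noteq> 0\<close> by simp
  ultimately show ?thesis using bar_bar by metis
qed

text \<open>
  The middle nucleus. Commuting with one scalar \<open>\<mu>\<close> that is not fixed by \<open>bar\<close> separates the
  entries of \<open>form\<close>; substituting vectors on the axes then determines \<open>T\<close>.
\<close>
lemma middle_nucleus_scalar:
  assumes T: "\<And>z w. mul (T z) w = mul z (T w)"
  obtains c where "\<phi> c = c" and "\<And>z. T z = scale2 c z"
proof -
  have one: "(1, 0) \<noteq> (0 :: 'a \<times> 'a)" by (simp add: zero_prod_def)
  have T_add: "T (z + w) = T z + T w" for z w
    by (rule mul_left_cancel[OF one]) (simp add: T mul_add_left)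
  obtain \<mu> where \<mu>: "\<phi> \<mu> = \<mu>" "bar \<mu> \<noteq> \<mu>" using bar_nontrivial by blast
  \<comment> \<open>Both sides have the same product with \<open>z\<close>: \<open>T\<close> moves
    to the other factor, then the scalar moves back, and a nonzero \<open>z\<close> cancels.\<close>
  have comm: "T (scale2 \<mu> z) = scale2 \<mu> (T z)" for z
  proof (cases "z = 0")
    case True
    thus ?thesis using additive_zero[OF T_add] by (simp add: scale2_def zero_prod_def)
  next
    case False
    have "mul (T (scale2 \<mu> z)) z = mul (scale2 \<mu> z) (T z)" by (rule T)
    also have "\<dots> = mul (scale2 \<mu> (T z)) z"
      by (subst mul_scale[OF \<mu>(1)]) (rule mul_commute)
    finally show ?thesis using mul_left_cancel[OF False] by blast
  qed
  \<comment> \<open>Scaling \<open>z\<close> by \<open>\<mu>\<close> supplies the second equation of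
    the system. The second component is divided by \<open>A\<close> to bring it into the same shape
    as the first.\<close>
  have T_form: "form a b (T z) w = form a b z (T w)" if ab: "a \<in> {fst, snd}" "b \<in> {fst, snd}" for a b z w
  proof -
    have 1: "mul (T z) w = mul z (T w)" by (rule T)
    have 2: "mul (scale2 \<mu> (T z)) w = mul (scale2 \<mu> z) (T w)"
      using T[of "scale2 \<mu> z" w] by (simp add: comm)
    have "form fst fst (T z) w = form fst fst z (T w) \<and> form snd snd (T z) w = form snd snd z (T w)"
      using 1 2 by (intro bar_system_unique[OF \<mu>(2) B_nonzero]) (simp_all add: mul_def form_scale_left \<mu>(1))
    moreover have "form snd fst (T z) w = form snd fst z (T w) \<and> form fst snd (T z) w = form fst snd z (T w)"
    proof (rule bar_system_unique[of \<mu> "inverse A"])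
      show "form snd fst (T z) w + inverse A * bar (form fst snd (T z) w) =
          form snd fst z (T w) + inverse A * bar (form fst snd z (T w))"
        using 1 by (simp add: mul_def field_simps)
      show "\<mu> * form snd fst (T z) w + inverse A * bar (\<mu> * form fst snd (T z) w) =
          \<mu> * form snd fst z (T w) + inverse A * bar (\<mu> * form fst snd z (T w))"
        using 2 by (simp add: mul_def form_scale_left \<mu>(1) field_simps)
    qed (use \<mu> in auto)
    ultimately show ?thesis using ab by auto
  qed
  define h11 where "h11 = (\<lambda>x. fst (T (x, 0)))"
  define h21 where "h21 = (\<lambda>x. snd (T (x, 0)))"
  define h12 where "h12 = (\<lambda>x. fst (T (0, x)))"
  define h22 where "h22 = (\<lambda>x. snd (T (0, x)))"
  \<comment> \<open>The second relation makes \<open>h\<close> a multiple of \<open>\<phi>\<close>;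
    the first then gives \<open>\<phi> (\<phi> y) * \<phi> (h 1) = y * \<phi> (h 1)\<close>, and
    some \<open>y\<close> is moved by the square of \<open>\<phi>\<close>.\<close>
  have zero: "h x = 0" if h: "\<And>x u. \<phi> (h x) * u = \<phi> (h u) * x" "\<And>x u. \<phi> u * h x = \<phi> x * h u" for h x
  proof -
    obtain y where y: "\<phi> (\<phi> y) \<noteq> y" using phi_phi_nontrivial by blast
    have hx: "h x = \<phi> x * h 1" for x
      using h(2)[of 1 x] phi_one by simp
    have "\<phi> (\<phi> y) * \<phi> (h 1) = y * \<phi> (h 1)"
      using h(1)[of y 1] hx[of y] by (simp add: phi_mult)
    hence "h 1 = 0" using y by simp
    thus ?thesis using hx[of x] by simp
  qed
  have "h21 x = 0" for x
  proof (rule zero[of h21])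
    show "\<phi> (h21 x) * u = \<phi> (h21 u) * x" for x u
      using T_form[of snd fst "(x, 0)" "(u, 0)"] by (simp add: form_def h21_def)
    show "\<phi> u * h21 x = \<phi> x * h21 u" for x u
      using T_form[of fst snd "(x, 0)" "(u, 0)"] by (simp add: form_def h21_def)
  qed
  have "h12 x = 0" for x
  proof (rule zero[of h12])
    show "\<phi> (h12 x) * u = \<phi> (h12 u) * x" for x u
      using T_form[of fst snd "(0, x)" "(0, u)"] by (simp add: form_def h12_def)
    show "\<phi> u * h12 x = \<phi> x * h12 u" for x u
      using T_form[of snd fst "(0, x)" "(0, u)"] by (simp add: form_def h12_def)
  qed
  have *: "\<phi> (h11 x) * v = \<phi> x * h22 v" for x v
    using T_form[of fst snd "(x, 0)" "(0, v)"] by (simp add: form_def h11_def h22_def)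
  have **: "\<phi> v * h11 x = \<phi> (h22 v) * x" for x v
    using T_form[of snd fst "(x, 0)" "(0, v)"] by (simp add: form_def h11_def h22_def)
  define c where "c = h11 1"
  have h22: "h22 v = \<phi> c * v" for v
    using *[of 1 v] phi_one by (simp add: c_def)
  have h11: "h11 x = x * c" for x
    using *[of x 1] h22[of 1] by (intro phi_inject[of "h11 x"]) (simp add: phi_mult)
  \<comment> \<open>The mixed relations give \<open>h22 1 = \<phi> c\<close> and
    \<open>c = \<phi> (h22 1)\<close>, so \<open>c\<close> is fixed by the square of
    \<open>\<phi>\<close>.\<close>
  have c: "\<phi> c = c"
    using **[of 1 1] h22[of 1] phi_one by (intro phi_phi_fixed[of c]) (simp add: c_def)
  have "T z = scale2 c z" for z
  proof -
    have "T z = T (fst z, 0) + T (0, snd z)"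
      using T_add[of "(fst z, 0)" "(0, snd z)"] by simp
    also have "\<dots> = scale2 c z"
      using \<open>\<And>x. h21 x = 0\<close> \<open>\<And>x. h12 x = 0\<close> h11 h22 c
      by (simp add: prod_eq_iff scale2_def h11_def h12_def h21_def h22_def mult.commute)
    finally show ?thesis .
  qed
  with c that show ?thesis by blast
qed

section \<open>Structure of an autotopism\<close>

text \<open>Independence of the characters identity and \<open>bar\<close>, tested at 1 and at an
  element that \<open>bar\<close> moves.\<close>

lemma bar_independent:
  assumes "\<And>x. \<alpha> * x + \<beta> * bar x = \<alpha>' * x + \<beta>' * bar x"
  shows "\<alpha> = \<alpha>' \<and> \<beta> = \<beta>'"
proof -
  obtain \<mu> where \<mu>: "bar \<mu> \<noteq> \<mu>" using bar_nontrivial by blast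
  have 1: "\<alpha> + \<beta> = \<alpha>' + \<beta>'" using assms[of 1] by simp
  have "(\<beta> - \<beta>') * (bar \<mu> - \<mu>) = 
      (\<alpha> * \<mu> + \<beta> * bar \<mu> - (\<alpha>' * \<mu> + \<beta>' * bar \<mu>)) - \<mu> * (\<alpha> + \<beta> - (\<alpha>' + \<beta>'))"
    by (simp add: algebra_simps)
  also have "\<dots> = 0" using 1 assms[of \<mu>] by simp
  finally show ?thesis using \<mu> 1 by simp
qed

text \<open>The kernel is trivial by \<open>phi_uminus_fixed\<close>. Every field element thus
  occurs as a diagonal form of an axis vector with a unit vector.\<close>

lemma surj_add_phi: "surj (\<lambda>x. \<phi> x + x)"
proof (intro finite_UNIV_inj_surj injI)
  fix x y assume "\<phi> x + x = \<phi> y + y"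
  hence "\<phi> (x - y) = - (x - y)" by (simp add: phi_minus algebra_simps)
  thus "x = y" using phi_uminus_fixed by fastforce
qed simp

text \<open>Commutativity gives two expressions for \<open>X (mul z w)\<close>; equating them is the
  middle nucleus identity for \<open>W \<circ> inv Y\<close>.\<close>

lemma autotopism_partner:
  assumes X: "\<And>x y. X (x + y) = X x + X y" "inj X" and "bij Y"
    and XYW: "\<And>z w. X (mul z w) = mul (Y z) (W w)"
  obtains t where "\<phi> t = t" and "t \<noteq> 0" and "\<And>z. W z = scale2 t (Y z)"
proof -
  have Y: "Y (inv Y z) = z" for z
    using \<open>bij Y\<close> by (simp add: bij_is_surj surj_f_inv_f)
  define T where "T = W \<circ> inv Y"
  have "mul (T z) w = mul z (T w)" for z w
  proof -
    have "mul (T z) w = mul (Y (inv Y w)) (W (inv Y z))"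
      by (simp add: T_def Y mul_commute)
    also have "\<dots> = X (mul (inv Y w) (inv Y z))"
      by (rule XYW[symmetric])
    also have "\<dots> = mul (Y (inv Y z)) (W (inv Y w))"
      by (subst mul_commute) (rule XYW)
    finally show ?thesis by (simp add: T_def Y)
  qed
  then obtain t where t: "\<phi> t = t" "\<And>z. T z = scale2 t z"
    using middle_nucleus_scalar by blast
  have W: "W z = scale2 t (Y z)" for z
    using t(2)[of "Y z"] \<open>bij Y\<close> by (simp add: T_def bij_is_inj)
  have "t \<noteq> 0"
  proof
    assume "t = 0"
    hence "X (mul (1, 0) (1, 0)) = X 0"
      using XYW[of "(1, 0)" "(1, 0)"] W additive_zero[OF X(1)]
      by (simp add: scale2_def flip: zero_prod_def)
    hence "mul (1, 0) (1, 0) = 0" using X(2) by (simp add: inj_eq)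
    thus False unfolding mul_eq_0_iff by (simp add: zero_prod_def)
  qed
  with t(1) W that show ?thesis by blast
qed

text \<open>Conjugating multiplication by \<open>\<mu>\<close> with \<open>Y\<close> again satisfies
  the middle nucleus identity, since \<open>\<mu>\<close> moves between the factors and
  \<open>X\<close> is injective.\<close>

lemma normalizes_middle_nucleus:
  assumes X: "inj X" and "bij Y" and t: "\<phi> t = t" and \<mu>: "\<phi> \<mu> = \<mu>"
    and XY: "\<And>z w. X (mul z w) = mul (Y z) (scale2 t (Y w))"
  obtains \<nu> where "\<phi> \<nu> = \<nu>" and "\<And>z. Y (scale2 \<nu> z) = scale2 \<mu> (Y z)"
proof -
  define S where "S = (\<lambda>z. inv Y (scale2 \<mu> (Y z)))"
  have YS: "Y (S z) = scale2 \<mu> (Y z)" for z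
    using \<open>bij Y\<close> by (simp add: S_def bij_is_surj surj_f_inv_f)
  have "mul (S z) w = mul z (S w)" for z w
  proof (rule injD[OF X])
    have "mul (scale2 \<mu> (Y z)) (scale2 t (Y w)) = mul (Y z) (scale2 \<mu> (scale2 t (Y w)))"
      by (rule mul_scale[OF \<mu>])
    also have "scale2 \<mu> (scale2 t (Y w)) = scale2 t (scale2 \<mu> (Y w))"
      by (simp add: scale2_def mult.left_commute)
    finally show "X (mul (S z) w) = X (mul z (S w))" by (simp add: XY YS)
  qed
  then obtain \<nu> where "\<phi> \<nu> = \<nu>" "\<And>z. S z = scale2 \<nu> z"
    using middle_nucleus_scalar by blast
  with that YS show ?thesis by simp
qed

text \<open>One product only yields a sum of two forms; the product with \<open>\<mu>\<close> times
  \<open>z\<close> gives a second equation. Solving this system is additive in the two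
  products.\<close>

lemma form_determined_by_mul:
  assumes t: "\<phi> t = t" "t \<noteq> 0" and \<mu>: "\<phi> \<mu> = \<mu>" "bar \<mu> \<noteq> \<mu>" and ab: "a \<in> {fst, snd}" "b \<in> {fst, snd}"
  obtains \<Gamma> where "\<And>f f' g g'. \<Gamma> (f + f') (g + g') = \<Gamma> f g + (\<Gamma> f' g' :: 'a)"
    and "\<And>z w. form a b z w = \<Gamma> (mul z (scale2 t w)) (mul (scale2 \<mu> z) (scale2 t w))"
proof -
  \<comment> \<open>\<open>F\<close> and \<open>G\<close> solve for the entry outside and inside
    \<open>bar\<close>, respectively; \<open>b\<close> is \<open>B\<close> for the first component
    and \<open>inverse A\<close> for the second one divided by \<open>A\<close>.\<close>
  define F where "F = (\<lambda>f g. (g - bar \<mu> * f) / (t * (\<mu> - bar \<mu>)))"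
  define G where "G = (\<lambda>b f g. bar ((g - \<mu> * f) / (b * bar t * (bar \<mu> - \<mu>))))"
  have F_add: "F (f + f') (g + g') = F f g + F f' g'" for f f' g g'
    by (simp add: F_def add_divide_distrib[symmetric] algebra_simps)
  have G_add: "G b (f + f') (g + g') = G b f g + G b f' g'" for b f f' g g'
    by (simp add: G_def bar_add[symmetric] add_divide_distrib[symmetric] algebra_simps)
  have F: "F (t * x + b * bar (t * y)) (\<mu> * (t * x) + b * bar (\<mu> * (t * y))) = x"
    if "b \<noteq> 0" for b x y
    using t(2) \<mu>(2) by (simp add: F_def bar_mult field_simps)
  have G: "G b (t * x + b * bar (t * y)) (\<mu> * (t * x) + b * bar (\<mu> * (t * y))) = y"
    if "b \<noteq> 0" for b x y
  proof -
    have "(\<mu> * (t * x) + b * bar (\<mu> * (t * y)) - \<mu> * (t * x + b * bar (t * y))) / (b * bar t * (bar \<mu> - \<mu>)) = bar y"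
      using that t(2) \<mu>(2) by (simp add: bar_mult field_simps)
    thus ?thesis by (simp add: G_def bar_bar)
  qed
  define \<Gamma> where "\<Gamma> = (\<lambda>f g :: 'a \<times> 'a.
    if a = fst \<and> b = fst then F (fst f) (fst g)
    else if a = snd \<and> b = snd then G B (fst f) (fst g)
    else if a = snd then F (snd f / A) (snd g / A)
    else G (inverse A) (snd f / A) (snd g / A))"
  have ne: "(fst :: 'a \<times> 'a \<Rightarrow> 'a) \<noteq> snd"
    by (metis fst_conv snd_conv zero_neq_one)
  have snd_mul: "snd (mul z w) / A = form snd fst z w + inverse A * bar (form fst snd z w)" for z w
    by (simp add: mul_def field_simps)
  show ?thesis
  proof (rule that[of \<Gamma>])
    show "\<Gamma> (f + f') (g + g') = \<Gamma> f g + \<Gamma> f' g'" for f f' g g'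
      by (simp add: \<Gamma>_def F_add G_add add_divide_distrib)
    show "form a b z w = \<Gamma> (mul z (scale2 t w)) (mul (scale2 \<mu> z) (scale2 t w))" for z w
      using ab ne F[OF B_nonzero] G[OF B_nonzero] F[of "inverse A"] G[of "inverse A"]
      unfolding \<Gamma>_def snd_mul
      by (auto simp: mul_def form_scale_left form_scale_right t \<mu> mult.left_commute[of t \<mu>])
  qed
qed

text \<open>On the axes, the only monomials that survive are \<open>\<phi> x * u\<close> and
  \<open>x * \<phi> u\<close>.\<close>

lemma mul_axes:
  assumes "i \<in> {\<lambda>x. (x, 0), \<lambda>x. (0, x)}" and "j \<in> {\<lambda>x. (x, 0), \<lambda>x. (0, x)}"
  obtains N N' :: "'a \<Rightarrow> 'a \<times> 'a" where "\<And>x y. N (x + y) = N x + N y"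
    and "\<And>x y. N' (x + y) = N' x + N' y" and "\<And>x u. mul (i x) (j u) = N (\<phi> x * u) + N' (x * \<phi> u)"
proof -
  define N1 :: "'a \<Rightarrow> 'a \<times> 'a" where "N1 = (\<lambda>x. (x, 0))"
  define N2 :: "'a \<Rightarrow> 'a \<times> 'a" where "N2 = (\<lambda>x. (B * bar x, 0))"
  define N3 :: "'a \<Rightarrow> 'a \<times> 'a" where "N3 = (\<lambda>x. (0, bar x))"
  define N4 :: "'a \<Rightarrow> 'a \<times> 'a" where "N4 = (\<lambda>x. (0, A * x))"
  note defs = N1_def N2_def N3_def N4_def
  have add: "N1 (x + y) = N1 x + N1 y" "N2 (x + y) = N2 x + N2 y"
    "N3 (x + y) = N3 x + N3 y" "N4 (x + y) = N4 x + N4 y" for x y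
    by (simp_all add: defs bar_add distrib_left)
  have mul: "mul (x, 0) (u, 0) = N1 (\<phi> x * u) + N1 (x * \<phi> u)"
    "mul (0, x) (0, u) = N2 (\<phi> x * u) + N2 (x * \<phi> u)"
    "mul (x, 0) (0, u) = N3 (\<phi> x * u) + N4 (x * \<phi> u)"
    "mul (0, x) (u, 0) = N4 (\<phi> x * u) + N3 (x * \<phi> u)" for x u
    by (simp_all add: defs mul_def form_def bar_add algebra_simps)
  from assms consider "i = (\<lambda>x. (x, 0))" "j = (\<lambda>x. (x, 0))" | "i = (\<lambda>x. (0, x))" "j = (\<lambda>x. (0, x))"
    | "i = (\<lambda>x. (x, 0))" "j = (\<lambda>x. (0, x))" | "i = (\<lambda>x. (0, x))" "j = (\<lambda>x. (x, 0))"
    by auto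
  thus ?thesis
  proof cases
    case 1 with add mul that[of N1 N1] show ?thesis by simp
  next
    case 2 with add mul that[of N2 N2] show ?thesis by simp
  next
    case 3 with add mul that[of N3 N4] show ?thesis by simp
  next
    case 4 with add mul that[of N4 N3] show ?thesis by simp
  qed
qed

text \<open>The form of the images is an additive function of \<open>mul z w\<close> and
  \<open>mul (scale2 \<nu> z) w\<close>, where \<open>\<nu>\<close> corresponds to
  \<open>\<mu>\<close> under \<open>Y\<close>. On the axes this becomes the hypothesis
  \<open>eq\<close> of \<open>additive_system_monomial\<close>.\<close>

lemma autotopism_components:
  assumes X: "\<And>x y. X (x + y) = X x + X y" "inj X" and "bij Y"
    and t: "\<phi> t = t" "t \<noteq> 0"
    and XY: "\<And>z w. X (mul z w) = mul (Y z) (scale2 t (Y w))"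
    and ab: "a \<in> {fst, snd}" "b \<in> {fst, snd}"
    and ij: "i \<in> {\<lambda>x. (x, 0), \<lambda>x. (0, x)}" "j \<in> {\<lambda>x. (x, 0), \<lambda>x. (0, x)}"
  shows "\<exists>L L'. (\<forall>x y. L (x + y) = L x + L y) \<and> (\<forall>x y. L' (x + y) = L' x + L' y) \<and>
    (\<forall>x u. \<phi> (a (Y (i x))) * b (Y (j u)) + b (Y (i x)) * \<phi> (a (Y (j u))) = L (\<phi> x * u) + L' (x * \<phi> u))"
proof -
  obtain \<mu> where \<mu>: "\<phi> \<mu> = \<mu>" "bar \<mu> \<noteq> \<mu>" using bar_nontrivial by blast
  obtain \<nu> where \<nu>: "\<phi> \<nu> = \<nu>" "\<And>z. Y (scale2 \<nu> z) = scale2 \<mu> (Y z)"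
    using normalizes_middle_nucleus[OF X(2) \<open>bij Y\<close> t(1) \<mu>(1) XY] by blast
  obtain \<Gamma> where \<Gamma>: "\<And>f f' g g'. \<Gamma> (f + f') (g + g') = \<Gamma> f g + (\<Gamma> f' g' :: 'a)"
    "\<And>z w. form a b z w = \<Gamma> (mul z (scale2 t w)) (mul (scale2 \<mu> z) (scale2 t w))"
    using form_determined_by_mul[OF t \<mu> ab] by blast
  obtain N N' where N: "\<And>x y. N (x + y) = N x + (N y :: 'a \<times> 'a)" "\<And>x y. N' (x + y) = N' x + (N' y :: 'a \<times> 'a)"
    "\<And>x u. mul (i x) (j u) = N (\<phi> x * u) + N' (x * \<phi> u)"
    using mul_axes[OF ij] by blast
  have form: "form a b (Y z) (Y w) = \<Gamma> (X (mul z w)) (X (mul (scale2 \<nu> z) w))" for z w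
    by (simp add: \<Gamma>(2) XY \<nu>(2))
  define L where "L = (\<lambda>v. \<Gamma> (X (N v)) (X (N (\<nu> * v))))"
  define L' where "L' = (\<lambda>v. \<Gamma> (X (N' v)) (X (N' (\<nu> * v))))"
  have "scale2 \<nu> (i x) = i (\<nu> * x)" for x
    using ij(1) by (auto simp: scale2_def)
  hence "form a b (Y (i x)) (Y (j u)) = L (\<phi> x * u) + L' (x * \<phi> u)" for x u
    unfolding form L_def L'_def \<Gamma>(1)[symmetric] X(1)[symmetric]
    by (simp add: N(3) phi_mult \<nu>(1) mult.assoc)
  hence "\<phi> (a (Y (i x))) * b (Y (j u)) + b (Y (i x)) * \<phi> (a (Y (j u))) = L (\<phi> x * u) + L' (x * \<phi> u)" for x u
    by (simp add: form_def mult.commute)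
  moreover have "L (x + y) = L x + L y" "L' (x + y) = L' x + L' y" for x y
    by (simp_all add: L_def L'_def distrib_left N X(1) \<Gamma>(1))
  ultimately show ?thesis by blast
qed

text \<open>
  Comparing the images of \<open>(B * bar \<rho>, 0)\<close> written as products on either axis gives four equations
  for the coefficients. If none of these vanishes, they make \<open>\<psi> B * bar (\<psi> B)\<close> equal to
  \<open>\<kappa> * \<phi> \<kappa>\<close> with \<open>bar \<kappa> = \<kappa>\<close>, which is impossible for a non-square.
\<close>
lemma monomial_autotopism_unmixed:
  assumes t: "\<phi> t = t" "t \<noteq> 0" and XY: "\<And>z w. X (mul z w) = mul (Y z) (scale2 t (Y w))"
    and Y: "\<And>x y. Y (x, y) = (a * \<psi> x + b * \<psi> y, c * \<psi> x + d * \<psi> y)"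
    and psi_add: "\<And>x y. \<psi> (x + y) = \<psi> x + \<psi> y" and psi_mult: "\<And>x y. \<psi> (x * y) = \<psi> x * \<psi> y"
    and psi_one: "\<psi> 1 = 1" and psi_phi: "\<And>x. \<psi> (\<phi> x) = \<phi> (\<psi> x)" and psi_bar: "\<And>x. \<psi> (bar x) = bar (\<psi> x)"
    and "surj \<psi>" "inj \<psi>"
  shows "(b = 0 \<and> c = 0) \<or> (a = 0 \<and> d = 0)"
proof -
  have psi_zero: "\<psi> 0 = 0" by (rule additive_zero[OF psi_add])
  define B' where "B' = \<psi> B"
  have B': "B' \<noteq> 0"
    using injD[OF \<open>inj \<psi>\<close>, of B 0] by (auto simp: B'_def psi_zero)
  \<comment> \<open>The elements \<open>x\<close> and \<open>y\<close> are chosen so that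
    \<open>mul (x, 0) (1, 0)\<close> and \<open>mul (0, y) (0, 1)\<close> agree, both being
    \<open>(B * bar \<sigma>, 0)\<close> with \<open>\<rho> = \<psi> \<sigma>\<close>.\<close>
  have eq: "(t * a * \<phi> a * B') * bar \<rho> + (B * bar (t * c * \<phi> c) * bar B') * \<rho> =
        (t * b * \<phi> b) * \<rho> + (B * bar (t * d * \<phi> d)) * bar \<rho> \<and>
      bar (t * \<phi> a * c * B') * \<rho> + (A * t * \<phi> c * a * B') * bar \<rho> =
        bar (t * \<phi> b * d) * bar \<rho> + (A * t * \<phi> d * b) * \<rho>" for \<rho>
  proof -
    obtain \<sigma> where \<sigma>: "\<rho> = \<psi> \<sigma>" using \<open>surj \<psi>\<close> by blast
    obtain y where y: "\<sigma> = \<phi> y + y" using surj_add_phi by blast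
    obtain x where x: "B * bar \<sigma> = \<phi> x + x" using surj_add_phi by blast
    have "mul (x, 0) (1, 0) = mul (0, y) (0, 1)"
      using x y by (simp add: mul_def form_def phi_one)
    hence "mul (Y (x, 0)) (scale2 t (Y (1, 0))) = mul (Y (0, y)) (scale2 t (Y (0, 1)))"
      unfolding XY[symmetric] by simp
    hence *: "mul (a * \<psi> x, c * \<psi> x) (t * a, t * c) = mul (b * \<psi> y, d * \<psi> y) (t * b, t * d)"
      by (simp add: Y psi_zero psi_one scale2_def)
    have psix: "\<phi> (\<psi> x) + \<psi> x = B' * bar \<rho>"
      using arg_cong[OF x, of \<psi>] by (simp add: psi_mult psi_add psi_phi psi_bar B'_def \<sigma>)
    have psiy: "\<phi> (\<psi> y) + \<psi> y = \<rho>"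
      using arg_cong[OF y, of \<psi>] by (simp add: psi_mult psi_add psi_phi psi_bar \<sigma>)
    have mul: "mul (a * x, c * x) (t * a, t * c) =
        (t * a * \<phi> a * (\<phi> x + x) + B * bar (t * c * \<phi> c * (\<phi> x + x)),
         bar (t * \<phi> a * c * (\<phi> x + x)) + A * (t * \<phi> c * a * (\<phi> x + x)))" for a c x
      by (simp add: mul_def form_def phi_mult t bar_add bar_mult algebra_simps)
    show ?thesis
      using * unfolding mul psix psiy by (simp add: bar_mult bar_bar mult_ac)
  qed
  have "B * bar (t * c * \<phi> c) * bar B' = t * b * \<phi> b \<and> t * a * \<phi> a * B' = B * bar (t * d * \<phi> d)"
    by (rule bar_independent) (use eq in \<open>simp add: add.commute\<close>)
  hence e1: "B * bar (t * c * \<phi> c) * bar B' = t * b * \<phi> b" and e2: "t * a * \<phi> a * B' = B * bar (t * d * \<phi> d)"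
    by simp_all
  have "bar (t * \<phi> a * c * B') = A * t * \<phi> d * b \<and> A * t * \<phi> c * a * B' = bar (t * \<phi> b * d)"
    by (rule bar_independent) (use eq in \<open>simp add: add.commute\<close>)
  hence e3: "bar (t * \<phi> a * c * B') = A * t * \<phi> d * b" by simp
  have ad: "a = 0 \<longleftrightarrow> d = 0"
    using arg_cong[OF e2, of "\<lambda>x. x = 0"] t(2) B' by simp
  have bc: "b = 0 \<longleftrightarrow> c = 0"
    using arg_cong[OF e1, of "\<lambda>x. x = 0"] t(2) B' by auto
  have "a = 0 \<or> b = 0"
  proof (rule ccontr)
    assume "\<not> (a = 0 \<or> b = 0)"
    with ad bc have nz: "a \<noteq> 0" "b \<noteq> 0" "c \<noteq> 0" "d \<noteq> 0" by auto
    \<comment> \<open>These quotients eliminate \<open>a\<close> and \<open>b\<close>; the factors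
      in \<open>c\<close> and \<open>d\<close> then cancel from the three equations.\<close>
    define \<tau> where "\<tau> = a / bar d"
    define \<sigma> where "\<sigma> = b / bar c"
    have nz': "\<tau> \<noteq> 0" "\<sigma> \<noteq> 0" using nz by (simp_all add: \<tau>_def \<sigma>_def)
    have ab: "a = \<tau> * bar d" "b = \<sigma> * bar c" using nz by (simp_all add: \<tau>_def \<sigma>_def)
    have e1': "B * bar B' * bar t = t * \<sigma> * \<phi> \<sigma>"
      using e1 nz unfolding ab by (simp add: bar_mult phi_mult phi_bar mult_ac)
    have e2': "t * \<tau> * \<phi> \<tau> * B' = B * bar t"
      using e2 nz unfolding ab by (simp add: bar_mult phi_mult phi_bar mult_ac)
    have e3': "bar t * bar (\<phi> \<tau>) * bar B' = A * t * \<sigma>"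
      using e3 nz unfolding ab by (simp add: bar_mult phi_mult phi_bar bar_bar mult_ac)
    have "A * t * (\<sigma> * bar \<tau>) = bar (t * \<tau> * \<phi> \<tau> * B')"
      using e3' by (simp add: bar_mult mult_ac)
    also have "\<dots> = bar B * t"
      unfolding e2' by (simp add: bar_mult bar_bar)
    finally have \<sigma>\<tau>: "\<sigma> * bar \<tau> = bar B / A"
      using t(2) by (simp add: field_simps)
    \<comment> \<open>This is \<open>\<sigma> / \<tau>\<close>, expanded by
      \<open>bar \<tau>\<close> so that numerator and denominator are each fixed by
      \<open>bar\<close>.\<close>
    define \<kappa> where "\<kappa> = (\<sigma> * bar \<tau>) / (\<tau> * bar \<tau>)"
    have "bar (bar B / A) = bar B / A"
      using AB_fixed by (simp add: bar_divide bar_bar field_simps)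
    hence "bar \<kappa> = \<kappa>"
      unfolding \<kappa>_def \<sigma>\<tau> bar_divide[of "bar B / A"] by (simp add: bar_mult bar_bar mult.commute)
    have \<kappa>: "\<kappa> = \<sigma> / \<tau>" using nz' by (simp add: \<kappa>_def)
    have "(t * \<tau> * \<phi> \<tau>) * (B' * bar B') = t * \<sigma> * \<phi> \<sigma>"
      using e1' e2' by (metis mult.assoc mult.commute)
    hence "B' * bar B' = \<kappa> * \<phi> \<kappa>"
      using nz' t(2) by (simp add: \<kappa> phi_divide field_simps)
    then obtain g where "B' = g ^ 2"
      using norm_nonsquare \<open>bar \<kappa> = \<kappa>\<close> by blast
    moreover obtain g' where "g = \<psi> g'" using \<open>surj \<psi>\<close> by blast
    ultimately have "\<psi> B = \<psi> (g' ^ 2)"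
      by (simp add: B'_def power2_eq_square psi_mult)
    thus False using injD[OF \<open>inj \<psi>\<close>] B_nonsquare by blast
  qed
  with ad bc show ?thesis by blast
qed

text \<open>Every vector is a product with \<open>(1, 0)\<close>, and scalars fixed by both
  \<open>\<phi>\<close> and \<open>bar\<close> can be pulled out of \<open>mul\<close>.\<close>

lemma autotopism_semilinear_left:
  assumes X: "\<And>x y. X (x + y) = X x + X y"
    and XYW: "\<And>z w. X (mul z w) = mul (Y z) (W w)"
    and \<nu>: "\<phi> \<nu> = \<nu>" "bar \<nu> = \<nu>" and \<nu>': "\<phi> \<nu>' = \<nu>'" "bar \<nu>' = \<nu>'"
    and Y: "\<And>z. Y (scale2 \<nu> z) = scale2 \<nu>' (Y z)"
  shows "X (scale2 \<nu> z) = scale2 \<nu>' (X z)"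
proof -
  have scale: "mul (scale2 c z) w = scale2 c (mul z w)" if "\<phi> c = c" "bar c = c" for c z w
    using that by (simp add: prod_eq_iff mul_def form_scale_left fst_scale2 snd_scale2 bar_mult algebra_simps)
  obtain z' where "z = mul z' (1, 0)"
    using surjD[OF surj_mul[of "(1, 0)"], of z] by (auto simp: zero_prod_def)
  thus ?thesis
    by (simp add: scale[OF \<nu>, symmetric] scale[OF \<nu>', symmetric] XYW Y)
qed

end

section \<open>The spread set\<close>

text \<open>With \<open>n = m div e\<close> odd, evenness of \<open>m\<close> passes to
  \<open>e = 2 * f\<close>. Then \<open>k + m div 2\<close> and \<open>m\<close> are
  \<open>f\<close> times \<open>2 * l + n\<close> and \<open>2 * n\<close>, which are coprime
  because \<open>n\<close> is odd and coprime to \<open>l\<close>.\<close>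

lemma gcd_add_half:
  fixes k m :: nat
  assumes "m > 0" and "even m" and "odd (m div gcd k m)"
  shows "even (gcd k m)" and "gcd (k + m div 2) m = gcd k m div 2"
    and "\<exists>j. m div 2 = gcd k m * j + gcd k m div 2"
proof -
  define e where "e = gcd k m"
  define n where "n = m div e"
  define l where "l = k div e"
  have m: "m = e * n" and k: "k = e * l"
    by (simp_all add: e_def n_def l_def)
  have "odd n" using assms(3) by (simp add: n_def e_def)
  with \<open>even m\<close> show "even (gcd k m)"
    by (subst (asm) m) (simp add: e_def)
  then obtain f where f: "e = 2 * f" unfolding e_def by blast
  have "coprime l n"
    using assms(1) unfolding l_def n_def e_def by (intro div_gcd_coprime) auto
  hence "coprime (2 * l) n" using \<open>odd n\<close> by simp
  hence "coprime (2 * l + n) n" by (simp add: coprime_iff_gcd_eq_1)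
  hence "gcd (2 * l + n) (2 * n) = 1" using \<open>odd n\<close> by (simp add: coprime_iff_gcd_eq_1[symmetric])
  moreover have "k + m div 2 = f * (2 * l + n)" "m = f * (2 * n)"
    unfolding m k f by (simp_all add: algebra_simps)
  ultimately have "gcd (k + m div 2) m = f"
    by (metis gcd_mult_distrib_nat mult.right_neutral)
  thus "gcd (k + m div 2) m = gcd k m div 2" using f by (simp add: e_def)
  obtain j where "n = 2 * j + 1" using \<open>odd n\<close> by (auto elim: oddE)
  hence "m div 2 = e * j + e div 2" unfolding m f by (simp add: algebra_simps)
  thus "\<exists>j. m div 2 = gcd k m * j + gcd k m div 2" unfolding e_def by blast
qed

lemma twisted_semifield_power:
  fixes A B :: "'a::{field,finite}" and E :: "'a set"
  assumes p: "prime p" "odd p" and m: "m > 0" "even m" and card: "card (UNIV :: 'a set) = p ^ m"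
    and k: "1 \<le> k" "k < m" and odd: "odd (m div gcd k m)" and E: "is_GF (p ^ gcd k m) E"
    and AB: "(A * B) ^ (p ^ (m div 2)) = A * B" "A * B \<noteq> 0" and B: "\<nexists>c. B = c ^ 2"
  shows "twisted_semifield (\<lambda>x. x ^ (p ^ k)) (\<lambda>x. x ^ (p ^ (m div 2))) A B"
proof -
  define h where "h = m div 2"
  define e where "e = gcd k m"
  define Q where "Q = p ^ h"
  have p1: "p > 1" using p(1) by (rule prime_gt_1_nat)
  have mh: "m = h + h" using m(2) unfolding h_def by auto
  have "odd Q" "Q > 0" using p p1 by (simp_all add: Q_def)
  have cardQ: "card (UNIV :: 'a set) = Q * Q"
    using card by (simp add: Q_def mh power_add)
  note pm = power_card_UNIV[OF card]
  note padd = power_prime_power_add[OF p(1) card]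
  have two: "(2 :: 'a) \<noteq> 0"
  proof
    assume "(2 :: 'a) = 0"
    hence "of_nat 2 = (0 :: 'a)" by simp
    hence "p dvd 2"
      using CHAR_eq_of_card_UNIV[OF p(1) card] by (simp only: of_nat_eq_0_iff_char_dvd)
    hence "p = 2" using p(1) p1 by (auto dest: dvd_imp_le)
    with p(2) show False by simp
  qed
  obtain j where n: "m div e = 2 * j + 1" using odd unfolding e_def by (auto elim: oddE)
  \<comment> \<open>The odd number \<open>m div e\<close> of iterations of \<open>\<phi>\<close>
    gives the identity, so a fixed point of the square of \<open>\<phi>\<close> is a fixed point of
    \<open>\<phi>\<close>.\<close>
  have "k * (m div e) = m * (k div e)"
    by (simp add: e_def div_mult_swap mult.commute)
  hence dvd: "m dvd k * (2 * j + 1)" unfolding n by simp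
  have fixed: "x ^ (p ^ k) = x" if "x ^ (p ^ (2 * k)) = x" for x :: 'a
  proof -
    have "x = x ^ (p ^ (k * (2 * j + 1)))"
      using power_power_multiple[OF pm dvd] by simp
    also have "k * (2 * j + 1) = k + 2 * k * j" by (simp add: algebra_simps)
    also have "x ^ (p ^ (k + 2 * k * j)) = x ^ (p ^ k)"
      using that by (intro power_power_add_multiple) auto
    finally show ?thesis by simp
  qed
  have two_k: "(x ^ (p ^ k)) ^ (p ^ k) = x ^ (p ^ (2 * k))" for x :: 'a
    by (simp add: mult_2 power_add power_mult)
  \<comment> \<open>The exponent of Euler's criterion for the field of order \<open>Q * Q\<close>,
    split so that \<open>Q + 1\<close> produces norms.\<close>
  have euler: "\<exists>c. x = c ^ 2" if "x ^ ((Q + 1) * ((Q - 1) div 2)) = 1" for x :: 'a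
  proof (rule finite_field_squareI)
    show "odd (card (UNIV :: 'a set))" using cardQ \<open>odd Q\<close> by simp
    obtain l where "Q = 2 * l + 1" using \<open>odd Q\<close> by (auto elim: oddE)
    hence "(card (UNIV :: 'a set) - 1) div 2 = (Q + 1) * ((Q - 1) div 2)"
      unfolding cardQ by (simp add: algebra_simps)
    thus "x ^ ((card (UNIV :: 'a set) - 1) div 2) = 1" using that by simp
  qed
  have bar_fixed: "\<kappa> ^ (Q - 1) = 1" if "\<kappa> ^ Q = \<kappa>" "\<kappa> \<noteq> 0" for \<kappa> :: 'a
    using that \<open>Q > 0\<close> by (cases Q) auto
  have even_Q: "2 * ((Q - 1) div 2) = Q - 1" using \<open>odd Q\<close> by simp
  show ?thesis
    unfolding h_def[symmetric] Q_def[symmetric]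
  proof
    show "(x + y) ^ (p ^ k) = x ^ (p ^ k) + y ^ (p ^ k)" for x y :: 'a by (rule padd)
    show "(x + y) ^ Q = x ^ Q + y ^ Q" for x y :: 'a unfolding Q_def by (rule padd)
    show "(x * y) ^ (p ^ k) = x ^ (p ^ k) * y ^ (p ^ k)" "(x * y) ^ Q = x ^ Q * y ^ Q"
      for x y :: 'a by (simp_all add: power_mult_distrib)
    show "(x ^ Q) ^ Q = x" for x :: 'a
      using power_card_UNIV[OF cardQ, of x] by (simp add: power_mult)
    show "(x ^ Q) ^ (p ^ k) = (x ^ (p ^ k)) ^ Q" for x :: 'a
      by (simp add: mult.commute flip: power_mult)
    show "x = 0" if x: "x ^ (p ^ k) = - x" for x :: 'a
    proof -
      have "x ^ (p ^ (2 * k)) = x"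
        using two_k[of x] x p(2) by simp
      hence "x = - x" using fixed[of x] x by metis
      hence "2 * x = 0" by (simp only: mult_2 eq_neg_iff_add_eq_0[symmetric])
      thus "x = 0" using two by simp
    qed
    show "x ^ (p ^ k) = x" if "(x ^ (p ^ k)) ^ (p ^ k) = x" for x :: 'a
      using that fixed unfolding two_k by blast
    show "\<exists>x::'a. (x ^ (p ^ k)) ^ (p ^ k) \<noteq> x"
    proof (rule ccontr)
      assume "\<not> ?thesis"
      hence "{x::'a. x ^ (p ^ k) = x} = UNIV" using fixed unfolding two_k by blast
      moreover have "p ^ k > 1" using p1 k(1) by (intro one_less_power) auto
      ultimately have "p ^ m \<le> p ^ k" using card_power_eq_self_le[of "p ^ k", where ?'a = 'a] card by simp
      thus False using p1 k(2) by simp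
    qed
    \<comment> \<open>Otherwise \<open>bar\<close> would fix \<open>E\<close> pointwise. As
      \<open>h\<close> is congruent to \<open>e div 2\<close> modulo \<open>e\<close>, all
      \<open>p ^ e\<close> elements of \<open>E\<close> would be roots of a polynomial of degree
      \<open>p ^ (e div 2)\<close>.\<close>
    show "\<exists>\<mu>::'a. \<mu> ^ (p ^ k) = \<mu> \<and> \<mu> ^ Q \<noteq> \<mu>"
    proof (rule ccontr)
      assume neg: "\<not> ?thesis"
      obtain i where i: "h = e * i + e div 2"
        using gcd_add_half(3)[OF m odd] unfolding h_def e_def by blast
      have "e > 0" "even e" using m(1) gcd_add_half(1)[OF m odd] by (auto simp: e_def)
      have "E \<subseteq> {x. x ^ (p ^ (e div 2)) = x}"
      proof
        fix x assume "x \<in> E"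
        hence x: "x ^ (p ^ e) = x" using is_GF_power_card[OF E] by (simp add: e_def)
        hence "x ^ (p ^ k) = x" by (rule power_power_multiple) (simp add: e_def)
        hence "x ^ (p ^ h) = x" using neg by (auto simp: Q_def)
        moreover have "x ^ (p ^ h) = x ^ (p ^ (e div 2))"
          unfolding i add.commute[of "e * i"] using x by (intro power_power_add_multiple) auto
        ultimately show "x \<in> {x. x ^ (p ^ (e div 2)) = x}" by simp
      qed
      hence "card E \<le> card {x::'a. x ^ (p ^ (e div 2)) = x}" by (intro card_mono) auto
      also have "\<dots> \<le> p ^ (e div 2)"
        using p1 \<open>e > 0\<close> \<open>even e\<close> by (intro card_power_eq_self_le one_less_power) auto
      finally have "p ^ e \<le> p ^ (e div 2)" using E by (simp add: is_GF_def e_def)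
      thus False using p1 \<open>e > 0\<close> by simp
    qed
    show "A ^ Q * B ^ Q = A * B" using AB(1) by (simp add: power_mult_distrib Q_def h_def)
    show "\<exists>c. x * x ^ (p ^ k) = c ^ 2" for x :: 'a
    proof -
      have "x * x ^ (p ^ k) = x ^ (2 * ((p ^ k + 1) div 2))"
        using p(2) by simp
      thus ?thesis by (metis mult.commute power_mult)
    qed
    show "\<exists>c. \<kappa> = c ^ 2" if "\<kappa> ^ Q = \<kappa>" for \<kappa> :: 'a
    proof (cases "\<kappa> = 0")
      case False
      obtain l where l: "Q + 1 = 2 * l" using \<open>odd Q\<close> by (metis even_plus_one_iff evenE)
      have "(Q + 1) * ((Q - 1) div 2) = (Q - 1) * l"
        using even_Q unfolding l by (metis mult.assoc mult.commute)
      thus ?thesis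
        using bar_fixed[OF that False] by (intro euler) (simp add: power_mult)
    qed (intro exI[of _ 0], simp)
    show "\<exists>c. b = c ^ 2" if "\<kappa> ^ Q = \<kappa>" "b * b ^ Q = \<kappa> * \<kappa> ^ (p ^ k)" for \<kappa> b :: 'a
    proof (cases "\<kappa> = 0")
      case True
      thus ?thesis using that(2) by (intro exI[of _ 0]) auto
    next
      case False
      obtain l where l: "p ^ k + 1 = 2 * l" using p(2) by (metis even_plus_one_iff evenE even_power)
      \<comment> \<open>The power becomes one of the norm of \<open>b\<close>, hence of
        \<open>\<kappa> ^ (p ^ k + 1)\<close>; since \<open>p ^ k + 1\<close> is even, the exponent
        of \<open>\<kappa>\<close> is a multiple of \<open>Q - 1\<close>.\<close>
      have "b ^ ((Q + 1) * ((Q - 1) div 2)) = (b * b ^ Q) ^ ((Q - 1) div 2)"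
        by (simp only: power_mult power_add power_one_right mult.commute[of b])
      also have "\<dots> = \<kappa> ^ ((p ^ k + 1) * ((Q - 1) div 2))"
        unfolding that(2) by (simp only: power_mult power_add power_one_right mult.commute[of \<kappa>])
      also have "(p ^ k + 1) * ((Q - 1) div 2) = (Q - 1) * l"
        using even_Q unfolding l by (metis mult.assoc mult.commute)
      also have "\<kappa> ^ ((Q - 1) * l) = 1"
        using bar_fixed[OF that(1) False] by (simp add: power_mult)
      finally show ?thesis by (rule euler)
    qed
  qed (use two AB B in auto)
qed

section \<open>Return to the original coordinates\<close>

lemma field_automorphism_on_power:
  assumes "prime p" and "card (UNIV :: 'a::{field,finite} set) = p ^ m" and "is_subfield (K :: 'a set)"
  shows "field_automorphism_on K (\<lambda>c. c ^ (p ^ i))"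
proof -
  note padd = power_prime_power_add[OF assms(1,2)]
  have K: "1 \<in> K" "\<And>x y. x \<in> K \<Longrightarrow> y \<in> K \<Longrightarrow> x * y \<in> K"
    using assms(3) by (auto simp: is_subfield_def)
  have "x ^ n \<in> K" if "x \<in> K" for x n
    by (induction n) (use K that in auto)
  moreover have "inj_on (\<lambda>c. c ^ (p ^ i)) K"
  proof (rule inj_onI)
    fix x y :: 'a assume "x ^ (p ^ i) = y ^ (p ^ i)"
    hence "(x - y) ^ (p ^ i) = 0" using padd[of "x - y" y i] by simp
    thus "x = y" by simp
  qed
  ultimately have "bij_betw (\<lambda>c. c ^ (p ^ i)) K K"
    by (intro bij_betw_imageI endo_inj_surj) auto
  thus ?thesis by (simp add: field_automorphism_on_def padd power_mult_distrib)
qed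

lemma (in twisted_semifield) spread_map_eq_mul:
  assumes "\<And>x. \<phi> x = x ^ q" and "\<And>x. bar (\<phi> x) = x ^ r"
  shows "spread_map q r A B u v (x, y) = mul (x, bar y) (u, bar v)"
  using assms(2)[symmetric]
  by (simp add: spread_map_def mul_def form_def phi_bar bar_add bar_mult bar_bar assms(1)[symmetric] algebra_simps)

theorem theorem2p4:
  fixes p m k q r Q e d :: nat
    and A B :: "'a::{field,finite}"
    and Fp FQ E D :: "'a set"
    and X Y :: "'a \<times> 'a \<Rightarrow> 'a \<times> 'a"
  assumes "prime p" and "odd p"
    and "m > 0" and "even m"
    and "card (UNIV :: 'a set) = p ^ m"
    and "Q = p ^ (m div 2)"
    and "1 \<le> k" and "k \<le> m - 1"
    and "q = p ^ k" and "r = p ^ (k + m div 2)"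
    and "e = gcd k m" and "odd (m div e)"
    and "d = gcd (k + m div 2) m"
    and "is_GF p Fp" and "is_GF Q FQ" and "is_GF (p ^ e) E" and "is_GF (p ^ d) D"
    and "\<not> (\<exists>b. B = b ^ 2)"
    and "A * B \<in> FQ - {0}"
    and "bij X" and "linear_over Fp X"
    and "bij Y" and "linear_over Fp Y"
    and "{X \<circ> R \<circ> inv Y | R. R \<in> spread_set q r A B} = spread_set q r A B"
  shows "semilinear_over E Y \<and> semilinear_over D X"
proof -
  note p = \<open>prime p\<close> and card = \<open>card (UNIV :: 'a set) = p ^ m\<close>
  have "k < m" using \<open>m > 0\<close> \<open>k \<le> m - 1\<close> by simp
  have "(A * B) ^ Q = A * B"
    using is_GF_power_card[OF \<open>is_GF Q FQ\<close>] \<open>A * B \<in> FQ - {0}\<close> by blast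
  define \<phi> where "\<phi> = (\<lambda>x :: 'a. x ^ q)"
  define bar where "bar = (\<lambda>x :: 'a. x ^ Q)"
  interpret twisted_semifield \<phi> bar A B
    using assms \<open>k < m\<close> \<open>(A * B) ^ Q = A * B\<close> unfolding \<phi>_def bar_def
    by (simp only:, intro twisted_semifield_power) auto
  have X: "X (z + w) = X z + X w" and Y: "Y (z + w) = Y z + Y w" for z w
    using \<open>linear_over Fp X\<close> \<open>linear_over Fp Y\<close> unfolding linear_over_def by blast+
  define \<rho> where "\<rho> = (\<lambda>z :: 'a \<times> 'a. (fst z, bar (snd z)))"
  have \<rho>: "\<rho> (\<rho> z) = z" "\<rho> (z + w) = \<rho> z + \<rho> w" for z w
    by (simp_all add: \<rho>_def bar_bar bar_add)
  have spread: "spread_map q r A B u v z = mul (\<rho> z) (\<rho> (u, v))" for u v z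
    using spread_map_eq_mul[of q r u v "fst z" "snd z"]
    by (simp add: \<rho>_def \<phi>_def bar_def assms(6,9,10) power_add power_mult)
  define Y' where "Y' = \<rho> \<circ> Y \<circ> \<rho>"
  have "bij \<rho>" using \<rho>(1) by (intro o_bij[of \<rho>]) auto
  hence "bij Y'" using \<open>bij Y\<close> by (simp add: Y'_def bij_comp)
  have Y'_add: "Y' (z + w) = Y' z + Y' w" for z w by (simp add: Y'_def \<rho> Y)
  have Y_eq: "Y z = \<rho> (Y' (\<rho> z))" for z by (simp add: Y'_def \<rho>)
  \<comment> \<open>Multiplication by \<open>w\<close> is a member of the spread set up to the
    coordinate change \<open>\<rho>\<close>; its image under the hypothesis is another member, whose
    parameters provide \<open>w'\<close>.\<close>
  have "\<exists>w'. \<forall>z. X (mul z w) = mul (Y' z) w'" for w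
  proof -
    obtain u v where uv: "\<rho> w = (u, v)" by fastforce
    have "X \<circ> spread_map q r A B u v \<circ> inv Y \<in> spread_set q r A B"
      using assms(24) unfolding spread_set_def by blast
    then obtain u' v' where uv': "X \<circ> spread_map q r A B u v \<circ> inv Y = spread_map q r A B u' v'"
      unfolding spread_set_def by blast
    have "X (mul z w) = mul (Y' z) (\<rho> (u', v'))" for z
      using fun_cong[OF uv', of "Y (\<rho> z)"] \<open>bij Y\<close>
      by (simp add: spread \<rho>(1) bij_is_inj Y'_def flip: uv)
    thus ?thesis by blast
  qed
  then obtain W where XYW: "\<And>z w. X (mul z w) = mul (Y' z) (W w)" by metis
  have "inj X" using \<open>bij X\<close> by (rule bij_is_inj)
  obtain t where t: "\<phi> t = t" "t \<noteq> 0" "\<And>z. W z = scale2 t (Y' z)"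
    using autotopism_partner[OF X \<open>inj X\<close> \<open>bij Y'\<close> XYW] by blast
  have XY: "X (mul z w) = mul (Y' z) (scale2 t (Y' w))" for z w
    by (simp add: XYW t(3))
  \<comment> \<open>Booleans serve as the common index type for components and axes that
    \<open>additive_system_monomial\<close> expects.\<close>
  define P where "P = (\<lambda>a. if a then fst else snd :: 'a \<times> 'a \<Rightarrow> 'a)"
  define I where "I = (\<lambda>c. if c then (\<lambda>x. (x, 0)) else (\<lambda>x. (0, x)) :: 'a \<Rightarrow> 'a \<times> 'a)"
  have "\<exists>s. \<forall>a c. \<exists>\<eta>. \<forall>x. P a (Y' (I c x)) = \<eta> * x ^ (p ^ s)"
  proof (rule additive_system_monomial[OF p card two \<open>k < m\<close>])
    \<comment> \<open>The odd number \<open>m div e\<close> is coprime to 4 and to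
      \<open>k div e\<close>, so divisibility would make it 1 and give \<open>m = e\<close>, which
      is at most \<open>k\<close>.\<close>
    show "\<not> m dvd 4 * k"
    proof
      assume "m dvd 4 * k"
      hence "m div e dvd 4 * (k div e)"
        by (metis assms(11) div_dvd_div dvd_mult gcd_dvd1 gcd_dvd2 div_mult_swap)
      moreover have "coprime (m div e) (k div e)"
        using \<open>m > 0\<close> unfolding assms(11) by (metis coprime_commute div_gcd_coprime less_numeral_extra(3))
      moreover have "coprime (m div e) (2 ^ 2)"
        unfolding coprime_power_right_iff using assms(12) by simp
      hence "coprime (m div e) 4" by simp
      ultimately have "m div e dvd 1"
        by (metis coprime_dvd_mult_right_iff coprime_common_divisor dvd_refl)
      moreover have "e dvd m" "e \<le> k"
        using assms(11) \<open>1 \<le> k\<close> gcd_le1_nat[of k m] by simp_all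
      ultimately have "m \<le> k"
        using dvd_div_mult_self[of e m] by simp
      thus False using \<open>k < m\<close> by simp
    qed
    show "P a (Y' (I c (x + y))) = P a (Y' (I c x)) + P a (Y' (I c y))" for a c x y
      using Y'_add[of "(x, 0)" "(y, 0)"] Y'_add[of "(0, x)" "(0, y)"] by (simp add: P_def I_def)
    show "\<exists>L L'. (\<forall>x y. L (x + y) = L x + L y) \<and> (\<forall>x y. L' (x + y) = L' x + L' y) \<and>
      (\<forall>x u. P a (Y' (I c x)) ^ (p ^ k) * P b (Y' (I d u)) + P b (Y' (I c x)) * P a (Y' (I d u)) ^ (p ^ k) =
             L (x ^ (p ^ k) * u) + L' (x * u ^ (p ^ k)))" for a b c d
      using autotopism_components[OF X \<open>inj X\<close> \<open>bij Y'\<close> t(1,2) XY, of "P a" "P b" "I c" "I d"]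
      by (simp add: P_def I_def \<phi>_def assms(9))
  qed
  then obtain s where s: "\<And>a c. \<exists>\<eta>. \<forall>x. P a (Y' (I c x)) = \<eta> * x ^ (p ^ s)" by blast
  define \<psi> where "\<psi> = (\<lambda>x :: 'a. x ^ (p ^ s))"
  obtain a b c d' where abcd: "\<And>x. fst (Y' (x, 0)) = a * \<psi> x" "\<And>x. fst (Y' (0, x)) = b * \<psi> x"
      "\<And>x. snd (Y' (x, 0)) = c * \<psi> x" "\<And>x. snd (Y' (0, x)) = d' * \<psi> x"
    using s[of True True] s[of True False] s[of False True] s[of False False]
    unfolding P_def I_def \<psi>_def by (simp only: if_True if_False) metis
  have Y'_eq: "Y' (x, y) = (a * \<psi> x + b * \<psi> y, c * \<psi> x + d' * \<psi> y)" for x y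
    using Y'_add[of "(x, 0)" "(0, y)"] by (simp add: prod_eq_iff abcd)
  have psi: "\<psi> (x + y) = \<psi> x + \<psi> y" "\<psi> (x * y) = \<psi> x * \<psi> y" "\<psi> 1 = 1"
    "\<psi> (\<phi> x) = \<phi> (\<psi> x)" "\<psi> (bar x) = bar (\<psi> x)" for x y
    using power_prime_power_add[OF p card]
    by (simp_all add: \<psi>_def \<phi>_def bar_def power_mult_distrib mult.commute flip: power_mult)
  have auto: "field_automorphism_on K \<psi>" if "is_subfield K" for K
    unfolding \<psi>_def by (rule field_automorphism_on_power[OF p card that])
  have "bij \<psi>"
    using auto[of UNIV] by (simp add: field_automorphism_on_def is_subfield_def)
  have unmixed: "(b = 0 \<and> c = 0) \<or> (a = 0 \<and> d' = 0)"
    by (rule monomial_autotopism_unmixed[OF t(1,2) XY Y'_eq psi])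
       (use \<open>bij \<psi>\<close> in \<open>simp_all add: bij_is_inj bij_is_surj\<close>)
  have E: "is_subfield E" and D: "is_subfield D"
    using \<open>is_GF (p ^ e) E\<close> \<open>is_GF (p ^ d) D\<close> by (simp_all add: is_GF_def)
  have "semilinear_over E Y"
    unfolding semilinear_over_def
  proof (intro conjI allI)
    show "Y (z + w) = Y z + Y w" for z w by (rule Y)
    \<comment> \<open>In the diagonal case the two coordinate changes cancel. In the antidiagonal
      case each coordinate passes through \<open>bar\<close> once, so the companion automorphism is
      \<open>\<psi>\<close> composed with \<open>bar\<close>.\<close>
    from unmixed show "\<exists>\<sigma>. field_automorphism_on E \<sigma> \<and> (\<forall>c\<in>E. \<forall>z. Y (scale2 c z) = scale2 (\<sigma> c) (Y z))"
    proof
      assume "b = 0 \<and> c = 0"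
      hence "Y (scale2 \<mu> z) = scale2 (\<psi> \<mu>) (Y z)" for \<mu> z
        by (simp add: Y_eq \<rho>_def Y'_eq scale2_def psi bar_mult bar_bar)
      with auto[OF E] show ?thesis by blast
    next
      assume ad: "a = 0 \<and> d' = 0"
      have "Y (scale2 \<mu> z) = scale2 (\<psi> (bar \<mu>)) (Y z)" for \<mu> z
        using ad by (simp add: Y_eq \<rho>_def Y'_eq scale2_def psi bar_mult bar_bar)
      moreover have "field_automorphism_on E (\<lambda>\<mu>. \<psi> (bar \<mu>))"
        using field_automorphism_on_power[OF p card E, of "m div 2 + s"]
        by (simp add: \<psi>_def bar_def assms(6) power_add power_mult)
      ultimately show ?thesis by blast
    qed
  qed
  moreover have "semilinear_over D X"
    unfolding semilinear_over_def
  proof (intro conjI allI exI ballI)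
    show "X (z + w) = X z + X w" for z w by (rule X)
    show "field_automorphism_on D \<psi>" by (rule auto[OF D])
    fix \<mu> z assume "\<mu> \<in> D"
    \<comment> \<open>Here \<open>d\<close> divides both \<open>k\<close> and
      \<open>m div 2\<close>, the latter being \<open>e * j + d\<close>; hence the scalars in
      \<open>D\<close> are fixed by \<open>\<phi>\<close> and by \<open>bar\<close>.\<close>
    have d: "d = e div 2" "even e"
      using gcd_add_half[OF \<open>m > 0\<close> \<open>even m\<close>, of k] assms(11-13) by simp_all
    hence "d dvd e" by auto
    hence "d dvd k" unfolding assms(11) using dvd_trans gcd_dvd1 by blast
    have "d dvd m div 2"
      using gcd_add_half(3)[OF \<open>m > 0\<close> \<open>even m\<close>, of k] assms(11,12) d(1) \<open>d dvd e\<close> by auto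
    have \<mu>_d: "\<mu> ^ (p ^ d) = \<mu>" by (rule is_GF_power_card[OF \<open>is_GF (p ^ d) D\<close> \<open>\<mu> \<in> D\<close>])
    have \<mu>: "\<phi> \<mu> = \<mu>" "bar \<mu> = \<mu>"
      using power_power_multiple[OF \<mu>_d \<open>d dvd k\<close>] power_power_multiple[OF \<mu>_d \<open>d dvd m div 2\<close>]
      by (simp_all add: \<phi>_def bar_def assms(6,9))
    show "X (scale2 \<mu> z) = scale2 (\<psi> \<mu>) (X z)"
    proof (rule autotopism_semilinear_left[OF X XYW \<mu>])
      show "\<phi> (\<psi> \<mu>) = \<psi> \<mu>" "bar (\<psi> \<mu>) = \<psi> \<mu>" using \<mu> by (simp_all flip: psi)
      show "Y' (scale2 \<mu> z) = scale2 (\<psi> \<mu>) (Y' z)" for z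
        by (cases z) (simp add: Y'_eq scale2_def psi algebra_simps)
    qed
  qed
  ultimately show ?thesis ..
qed

end
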